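(* Fix $c\in(0,\infty)$, let $s_c=\frac1c\log(1+c)$, and fix $s\in(0,1)$ with $s\neq s_c$. Then there is a unique real number $a_s\in(0,\infty)\setminus\{1\}$ such that, with $b_s=a_s e^{c(1-1/a_s)}$, $$s=\frac1c\log\frac{b_s-1}{a_s-1}.$$ Moreover, for every sequence of real numbers $(s_n)$ with $s_n\to s$ as $n\to\infty$, $$\lim_{n\to\infty}\frac1n\log P_{s_n}=\log a_s+\frac1c\int_{a_s}^{b_s}\frac{\log u}{1-u}\,du .$$ Here $P_{s_n}=\mathbf{P}(S_g\le s_n n)$ if $s_n<s_c$ and $P_{s_n}=\mathbf{P}(S_g\ge s_n n)$ if $s_n>s_c$ (for all large $n$ the number $s_n$ lies on the same side of $s_c$ as $s$), where $S_g$ is the size of the independent set found by the greedy algorithm on the Erdős–Rényi random graph $\mathcal{G}(n,c/n)$.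
   Context: $\mathcal{G}(n,p)$ is the Erdős–Rényi random graph on the vertex set $[n]=\{1,\dots,n\}$, in which each pair of vertices is joined by an edge independently with probability $p$. Here $p=c/n$, where $c\in(0,\infty)$ is a fixed constant (and $n\ge c$). A set $I\subset[n]$ is independent if no two vertices in $I$ are neighbors. Greedy algorithm: initially all vertices are available, $A_0=[n]$, and $I_0=\emptyset$. In each step $k\ge1$, as long as $A_{k-1}\neq\emptyset$, a uniformly random vertex $v_k\in A_{k-1}$ is chosen and $I_k=I_{k-1}\cup\{v_k\}$. The set $A_k$ is obtained from $A_{k-1}$ by removing $v_k$ and all neighbors of $v_k$ in $A_{k-1}$. (So $A_k$ is the set of vertices not in $I_k$ with no neighbor in $I_k$.) The size of the independent set obtained is $S_g=\min\{k\ge0: A_k=\emptyset\}$. The probability $\mathbf{P}$ is over both the random graph and the random choices of the algorithm. All logarithms are natural. The integrand $\frac{\log u}{1-u}$ is extended continuously by the value $-1$ at $u=1$. *)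

theory Defs
  imports "HOL-Probability.Probability"
begin

text \<open>Simple graphs on \<open>{1..n}\<close> are represented by their edge sets, an edge being a two-element set.\<close>

definition vertex_pairs :: "nat \<Rightarrow> nat set set" where
  "vertex_pairs n = {e. e \<subseteq> {1..n} \<and> card e = 2}"

definition erdos_renyi :: "nat \<Rightarrow> real \<Rightarrow> nat set set pmf" where
  "erdos_renyi n p =
     map_pmf (\<lambda>f. {e \<in> vertex_pairs n. f e})
       (Pi_pmf (vertex_pairs n) False (\<lambda>_. bernoulli_pmf p))"

definition neighbours :: "nat set set \<Rightarrow> nat \<Rightarrow> nat set" where
  "neighbours E v = {u. {u, v} \<in> E}"

text \<open>
  One step of the greedy algorithm on the pair \<open>(I, A)\<close> of the current independent set and the
  set of available vertices. Once no vertex is available the state no longer changes.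
\<close>

definition greedy_step :: "nat set set \<Rightarrow> nat set \<times> nat set \<Rightarrow> (nat set \<times> nat set) pmf" where
  "greedy_step E = (\<lambda>(I, A).
     if A = {} then return_pmf (I, A)
     else do {
       v \<leftarrow> pmf_of_set A;
       return_pmf (insert v I, A - {v} - neighbours E v)
     })"

text \<open>
  The law of the trajectory \<open>k \<mapsto> (I\<^sub>k, A\<^sub>k)\<close> during the first \<open>m\<close> steps; the entries with
  index above \<open>m\<close> keep the initial value and carry no meaning.
\<close>

primrec greedy_run :: "nat set set \<Rightarrow> nat \<Rightarrow> nat \<Rightarrow> (nat \<Rightarrow> nat set \<times> nat set) pmf" where
  "greedy_run E n 0 = return_pmf (\<lambda>_. ({}, {1..n}))"
| "greedy_run E n (Suc m) = do {
     X \<leftarrow> greedy_run E n m;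
     x \<leftarrow> greedy_step E (X m);
     return_pmf (X(Suc m := x))
   }"

definition stopping_step :: "(nat \<Rightarrow> nat set \<times> nat set) \<Rightarrow> nat" where
  "stopping_step X = (LEAST k. snd (X k) = {})"

text \<open>
  The law of the number of greedy steps (the size of the independent set found) on the random graph with edge probability \<open>c / n\<close>. Every step before
  exhaustion removes a vertex, so \<open>A\<^sub>n = {}\<close> and \<open>n\<close> steps suffice. For \<open>n < c\<close> the
  parameter of \<open>bernoulli_pmf\<close> is truncated to 1, which affects only finitely many \<open>n\<close>.
\<close>

definition greedy_size :: "real \<Rightarrow> nat \<Rightarrow> nat pmf" where
  "greedy_size c n = do {
     E \<leftarrow> erdos_renyi n (c / real n);
     X \<leftarrow> greedy_run E n n;
     return_pmf (stopping_step X)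
   }"

definition s_crit :: "real \<Rightarrow> real" where
  "s_crit c = 1 / c * ln (1 + c)"

text \<open>
  The lower tail below \<open>s_crit c\<close> and the upper tail above it. The value at \<open>t = s_crit c\<close> is
  a mere convention: a sequence with a limit other than \<open>s_crit c\<close> eventually avoids this point.
\<close>

definition tail_prob :: "real \<Rightarrow> nat \<Rightarrow> real \<Rightarrow> real" where
  "tail_prob c n t =
     (if t < s_crit c then measure_pmf.prob (greedy_size c n) {k. real k \<le> t * real n}
      else measure_pmf.prob (greedy_size c n) {k. real k \<ge> t * real n})"

definition b_of :: "real \<Rightarrow> real \<Rightarrow> real" where
  "b_of c a = a * exp (c * (1 - 1 / a))"

definition rate_integrand :: "real \<Rightarrow> real" where
  "rate_integrand u = (if u = 1 then -1 else ln u / (1 - u))"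

end

theory Submission
  imports Defs "HOL-Real_Asymp.Real_Asymp"
begin

text \<open>
  Write \<open>q = 1 - c / n\<close>. The proof rests on one exact identity: for the random size \<open>S\<close> of the greedy set,
  the weight \<open>w a k = (\<Prod>j<k. 1 + (a - 1) / q ^ j)\<close> satisfies \<open>E (w a S) = a ^ n\<close> for every \<open>a\<close>
  (\<open>expectation_weight_greedy_size\<close>). It holds because the edges among the vertices that survive a step have not
  been inspected yet, so that the number of survivors is binomial and the rest of the run is a greedy run
  on a fresh random graph.

  For \<open>k \<approx> x * n\<close> the logarithm of \<open>w a k\<close> is \<open>n\<close> times a Riemann sum, and \<open>ln (a ^ n / w a k) / n\<close> tends to the exponent
  \<open>\<Phi> a x = ln a - (integral of ln (1 + (a - 1) * exp (c * y)) over y from 0 to x)\<close>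
  (\<open>exponent_sequence_tendsto\<close>). The weight is increasing in \<open>k\<close> for \<open>a > 1\<close> and decreasing for \<open>a < 1\<close>, so Markov's
  inequality bounds the upper or lower tail at \<open>s\<close> by \<open>exp (n * \<Phi> a s)\<close> up to subexponential factors. Minimizing over \<open>a\<close>
  gives \<open>1 + (a - 1) * exp (c * s) = b_of c a\<close>, which is the equation of the theorem, and the substitution
  \<open>u = 1 + (a - 1) * exp (c * y)\<close> turns \<open>\<Phi> a s\<close> into the stated rate (\<open>exponent_profile_point\<close>). Since \<open>b_of c\<close> is
  strictly convex and equals \<open>1\<close> at \<open>1\<close>, the equation has exactly one solution other than \<open>1\<close>, on the side
  of \<open>1\<close> that corresponds to the side of \<open>s_crit c\<close> on which \<open>s\<close> lies.

  For the matching lower bound, \<open>w a / a ^ n\<close> is viewed as a density. Under the tilted law the size concentrates near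
  \<open>n * profile_point c a\<close> (\<open>weight_concentrates\<close>): away from this point \<open>a\<close> does not minimize the exponent, and a nearby parameter
  gives an exponentially smaller bound for the tilted mass. A parameter slightly further from \<open>1\<close> than the solution puts
  this typical size just inside the tail, and continuity of \<open>\<Phi>\<close> closes the gap.

  A density must be nonnegative. For \<open>a \<ge> 1\<close> this is automatic; for \<open>a < 1\<close> the parameters are
  restricted to \<open>1 - q ^ K\<close> with natural \<open>K\<close>, for which the weight reaches zero instead of changing sign. Such parameters become
  dense in the unit interval as \<open>n\<close> grows, which is why sequences of parameters appear throughout.
\<close>

section \<open>Expectations over independent coin flips\<close>

lemma expectation_bind_finite:
  fixes h :: "'b \<Rightarrow> real"
  assumes "finite (set_pmf p)" "\<And>x. x \<in> set_pmf p \<Longrightarrow> finite (set_pmf (f x))"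
  shows "measure_pmf.expectation (p \<bind> f) h =
    measure_pmf.expectation p (\<lambda>x. measure_pmf.expectation (f x) h)"
  by (subst pmf_expectation_bind[OF assms(1)])
     (use assms in \<open>auto simp: integral_measure_pmf[OF assms(1)]\<close>)

lemma expectation_pair_finite:
  fixes h :: "'a \<times> 'b \<Rightarrow> real"
  assumes "finite (set_pmf p)" "finite (set_pmf r)"
  shows "measure_pmf.expectation (pair_pmf p r) h =
    measure_pmf.expectation p (\<lambda>x. measure_pmf.expectation r (\<lambda>y. h (x, y)))"
  unfolding pair_pmf_def using assms by (simp add: expectation_bind_finite)

abbreviation coin_flips :: "real \<Rightarrow> 'a set \<Rightarrow> ('a \<Rightarrow> bool) pmf" where
  "coin_flips p D \<equiv> Pi_pmf D False (\<lambda>_. bernoulli_pmf p)"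

lemma finite_coin_flips: "finite D \<Longrightarrow> finite (set_pmf (coin_flips p D))"
  by (auto simp: set_Pi_pmf intro!: finite_PiE_dflt)

lemma expectation_coin_flips_Un:
  fixes h :: "('a \<Rightarrow> bool) \<Rightarrow> real"
  assumes "finite D" "finite D'" "D \<inter> D' = {}"
  shows "measure_pmf.expectation (coin_flips p (D \<union> D')) h =
    measure_pmf.expectation (coin_flips p D) (\<lambda>f.
      measure_pmf.expectation (coin_flips p D') (\<lambda>g. h (\<lambda>x. if x \<in> D then f x else g x)))"
  by (subst Pi_pmf_union[OF assms], simp, subst expectation_pair_finite)
     (auto intro: finite_coin_flips assms)

text \<open>The number of failures is binomial, and this is its generating function.\<close>

lemma expectation_power_failures:
  assumes "finite D" "0 \<le> p" "p \<le> 1"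
  shows "measure_pmf.expectation (coin_flips p D) (\<lambda>f. t ^ card {x \<in> D. \<not> f x}) =
    (p + (1 - p) * (t::real)) ^ card D"
  using assms(1)
proof (induction D)
  case (insert x D)
  have single: "measure_pmf.expectation (coin_flips p {x}) h =
      p * h ((\<lambda>_. False)(x := True)) + (1 - p) * h (\<lambda>_. False)" for h :: "_ \<Rightarrow> real"
    using assms by (subst Pi_pmf_singleton) (simp add: fun_upd_def)
  have "measure_pmf.expectation (coin_flips p ({x} \<union> D)) (\<lambda>f. t ^ card {y \<in> {x} \<union> D. \<not> f y}) =
      measure_pmf.expectation (coin_flips p {x}) (\<lambda>f. measure_pmf.expectation (coin_flips p D)
        (\<lambda>g. (if f x then 1 else t) * t ^ card {y \<in> D. \<not> g y}))"
    using insert.hyps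
  proof (subst expectation_coin_flips_Un, goal_cases)
    case 4
    have "{y \<in> {x} \<union> D. \<not> (if y \<in> {x} then f y else g y)} =
        (if f x then {} else {x}) \<union> {y \<in> D. \<not> g y}" for f g :: "'a \<Rightarrow> bool"
      using insert.hyps by auto
    then have "t ^ card {y \<in> {x} \<union> D. \<not> (if y \<in> {x} then f y else g y)} =
        (if f x then 1 else t) * t ^ card {y \<in> D. \<not> g y}" for f g :: "'a \<Rightarrow> bool"
      using insert.hyps by simp
    then show ?case by simp
  qed auto
  also have "\<dots> = (p + (1 - p) * t) * (p + (1 - p) * t) ^ card D"
    by (simp add: single insert.IH algebra_simps)
  finally show ?case using insert.hyps by simp
qed simp

section \<open>The number of greedy steps\<close>

text \<open>The law of the number of greedy steps from the available set \<open>A\<close>, by recursion on the first step.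
  The argument \<open>m\<close> only serves to make the recursion primitive: it is an upper bound on the number of
  steps and has no effect once \<open>card A \<le> m\<close>.\<close>

primrec steps :: "nat set set \<Rightarrow> nat \<Rightarrow> nat set \<Rightarrow> nat pmf" where
  "steps E 0 A = return_pmf 0"
| "steps E (Suc m) A = (if A = {} then return_pmf 0
     else pmf_of_set A \<bind> (\<lambda>v. map_pmf Suc (steps E m (A - {v} - neighbours E v))))"

lemma steps_empty [simp]: "steps E m {} = return_pmf 0"
  by (cases m) auto

lemma set_steps_subset: "finite A \<Longrightarrow> set_pmf (steps E m A) \<subseteq> {..m}"
proof (induction m arbitrary: A)
  case (Suc m)
  have "set_pmf (steps E m (A - {v} - neighbours E v)) \<subseteq> {..m}" for v
    using Suc.prems by (intro Suc.IH) auto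
  then show ?case
    using Suc.prems by (cases "A = {}") (auto simp: subset_iff)
qed simp

lemma finite_set_steps: "finite A \<Longrightarrow> finite (set_pmf (steps E m A))"
  using finite_subset[OF set_steps_subset] by simp

text \<open>A run on \<open>A\<close> only ever looks at edges inside \<open>A\<close>; this is the source of the independence used below.\<close>

lemma steps_cong:
  assumes "finite A" "\<And>u v. u \<in> A \<Longrightarrow> v \<in> A \<Longrightarrow> u \<noteq> v \<Longrightarrow> {u, v} \<in> E \<longleftrightarrow> {u, v} \<in> E'"
  shows "steps E m A = steps E' m A"
  using assms
proof (induction m arbitrary: A)
  case (Suc m)
  show ?case
  proof (cases "A = {}")
    case False
    have "steps E m (A - {v} - neighbours E v) = steps E' m (A - {v} - neighbours E' v)"
      if "v \<in> A" for v
    proof -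
      have "A - {v} - neighbours E v = A - {v} - neighbours E' v"
        using Suc.prems that by (auto simp: neighbours_def)
      moreover have "steps E m (A - {v} - neighbours E v) = steps E' m (A - {v} - neighbours E v)"
        using Suc.prems by (intro Suc.IH) auto
      ultimately show ?thesis by simp
    qed
    then show ?thesis
      using False Suc.prems(1)
      by (simp only: steps.simps if_False)
         (intro bind_pmf_cong refl arg_cong[where f = "map_pmf Suc"], simp)
  qed simp
qed simp

text \<open>Each step before exhaustion removes at least the chosen vertex, so that \<open>n\<close> steps suffice.\<close>

lemma greedy_run_available:
  assumes "X \<in> set_pmf (greedy_run E n m)"
  shows "finite (snd (X m)) \<and> card (snd (X m)) \<le> n - m"
  using assms
proof (induction m arbitrary: X)
  case (Suc m)
  then obtain Y x where Y: "Y \<in> set_pmf (greedy_run E n m)" "x \<in> set_pmf (greedy_step E (Y m))"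
    and X: "X = Y(Suc m := x)" by auto
  obtain I A where IA: "Y m = (I, A)" by (cases "Y m")
  have A: "finite A" "card A \<le> n - m" using Suc.IH[OF Y(1)] IA by auto
  show ?case
  proof (cases "A = {}")
    case True
    then show ?thesis using Y(2) by (simp add: X IA greedy_step_def)
  next
    case False
    have "x \<in> (\<lambda>v. (insert v I, A - {v} - neighbours E v)) ` A"
      using Y(2) False A(1) by (simp add: IA greedy_step_def image_iff)
    then obtain v where v: "v \<in> A" "snd x = A - {v} - neighbours E v" by auto
    have "card (A - {v} - neighbours E v) \<le> card (A - {v})" using A(1) by (intro card_mono) auto
    also have "\<dots> < card A" using v A(1) by (meson card_Diff1_less)
    finally show ?thesis using v A by (simp add: X)
  qed
qed simp

lemma stopping_step_update:
  assumes "\<exists>j\<le>m. snd (X j) = {}"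
  shows "stopping_step (X(Suc m := x)) = stopping_step X"
proof -
  obtain j where j: "j \<le> m" "snd (X j) = {}" using assms by auto
  have le: "stopping_step Y \<le> m" "snd (Y (stopping_step Y)) = {}" if "snd (Y j) = {}" for Y
    using j(1) Least_le[of "\<lambda>k. snd (Y k) = {}" j] LeastI[of "\<lambda>k. snd (Y k) = {}" j] that
    by (auto simp: stopping_step_def)
  let ?Y = "X(Suc m := x)"
  have Y: "snd (?Y j) = {}" using j by auto
  have "stopping_step ?Y \<le> stopping_step X"
    unfolding stopping_step_def[of ?Y] using le[of X] j(2) by (intro Least_le) auto
  moreover have "stopping_step X \<le> stopping_step ?Y"
    unfolding stopping_step_def[of X] using le[of ?Y] Y by (intro Least_le) (auto split: if_splits)
  ultimately show ?thesis by simp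
qed

text \<open>The trajectory is built by appending steps at the end, whereas the moment computation needs the first
  step split off. Downward induction on \<open>m\<close>, the number of steps kept as a trajectory, converts one
  description into the other.\<close>

lemma stopping_step_greedy_run:
  assumes "m \<le> n"
  shows "map_pmf stopping_step (greedy_run E n n) =
    greedy_run E n m \<bind> (\<lambda>X. if \<exists>j\<le>m. snd (X j) = {} then return_pmf (stopping_step X)
      else map_pmf ((+) m) (steps E (n - m) (snd (X m))))"
  using assms
proof (induction m rule: inc_induct)
  case base
  have "\<exists>j\<le>n. snd (X j) = {}" if "X \<in> set_pmf (greedy_run E n n)" for X
    using greedy_run_available[OF that] by auto
  then show ?case by (simp add: map_pmf_def cong: bind_pmf_cong)
next
  case (step m)
  let ?rest = "\<lambda>m X. if \<exists>j\<le>m. snd (X j) = {} then return_pmf (stopping_step X)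
      else map_pmf ((+) m) (steps E (n - m) (snd (X m)))"
  have "greedy_step E (X m) \<bind> (\<lambda>x. ?rest (Suc m) (X(Suc m := x))) = ?rest m X"
    if X: "X \<in> set_pmf (greedy_run E n m)" for X
  proof (cases "\<exists>j\<le>m. snd (X j) = {}")
    case True
    then obtain j where "j \<le> m" "snd (X j) = {}" by auto
    then have "\<exists>j\<le>Suc m. snd ((X(Suc m := x)) j) = {}" for x
      by (intro exI[of _ j]) auto
    then have "?rest (Suc m) (X(Suc m := x)) = return_pmf (stopping_step X)" for x
      using stopping_step_update[OF True] by simp
    then show ?thesis using True by simp
  next
    case False
    obtain I A where IA: "X m = (I, A)" by (cases "X m")
    have A: "A \<noteq> {}" "finite A" using False greedy_run_available[OF X] IA by force+
    \<comment> \<open>If the new available set \<open>B\<close> is empty, the run has just stopped at \<open>Suc m\<close>, which agrees with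
      the general formula because \<open>steps\<close> of the empty set is \<open>0\<close>.\<close>
    have rest: "?rest (Suc m) (X(Suc m := (J, B))) = map_pmf ((+) (Suc m)) (steps E (n - Suc m) B)"
      for J B
    proof (cases "B = {}")
      case True
      have "(LEAST k. snd ((X(Suc m := (J, B))) k) = {}) = Suc m"
        using True False by (intro Least_equality) (auto simp: not_less_eq_eq split: if_splits)
      then show ?thesis using True by (auto simp: stopping_step_def)
    next
      case nonempty: False
      have "\<not> (\<exists>j\<le>Suc m. snd ((X(Suc m := (J, B))) j) = {})"
        using False nonempty by (auto simp: le_Suc_eq split: if_splits)
      then show ?thesis by (simp only: if_False) simp
    qed
    obtain l where l: "n - m = Suc l" "n - Suc m = l"
      using step.hyps by (metis Suc_diff_Suc)
    have "greedy_step E (X m) \<bind> (\<lambda>x. ?rest (Suc m) (X(Suc m := x))) =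
        pmf_of_set A \<bind> (\<lambda>v. ?rest (Suc m) (X(Suc m := (insert v I, A - {v} - neighbours E v))))"
      using A by (simp add: IA greedy_step_def bind_assoc_pmf bind_return_pmf)
    also have "\<dots> = pmf_of_set A \<bind>
        (\<lambda>v. map_pmf ((+) (Suc m)) (steps E (n - Suc m) (A - {v} - neighbours E v)))"
      by (simp only: rest)
    also have "\<dots> = map_pmf ((+) m) (steps E (n - m) A)"
    proof -
      have "(+) (Suc m) = (\<lambda>k. m + Suc k)" by auto
      then show ?thesis unfolding l using A by (simp add: map_bind_pmf map_pmf_comp)
    qed
    also have "\<dots> = ?rest m X"
      by (simp only: if_not_P[OF False] IA snd_conv)
    finally show ?thesis .
  qed
  then show ?case
    unfolding step.IH by (simp add: bind_assoc_pmf bind_return_pmf cong: bind_pmf_cong)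
qed

lemma greedy_size_eq_steps:
  "greedy_size c n = coin_flips (c / real n) (vertex_pairs n) \<bind>
    (\<lambda>f. steps {e \<in> vertex_pairs n. f e} n {1..n})"
proof -
  have "map_pmf stopping_step (greedy_run E n n) = steps E n {1..n}" for E
    using stopping_step_greedy_run[of 0 n E]
    by (auto simp: bind_return_pmf bind_return_pmf' stopping_step_def map_pmf_def)
  then show ?thesis
    by (simp add: greedy_size_def erdos_renyi_def bind_map_pmf map_pmf_def[symmetric])
qed

lemma finite_vertex_pairs: "finite (vertex_pairs n)"
  by (rule finite_subset[of _ "Pow {1..n}"]) (auto simp: vertex_pairs_def)

lemma finite_set_greedy_size: "finite (set_pmf (greedy_size c n))"
  by (simp add: greedy_size_eq_steps finite_coin_flips finite_vertex_pairs finite_set_steps)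

section \<open>The exact moment identity\<close>

text \<open>The function of the size whose expectation can be computed exactly. With \<open>q = 1 - p\<close> it is the unique
  normalized solution of the recursion in \<open>weight_Suc_shift\<close> below, which mirrors one greedy step.\<close>

definition weight :: "real \<Rightarrow> real \<Rightarrow> nat \<Rightarrow> real" where
  "weight q a k = (\<Prod>j<k. 1 + (a - 1) / q ^ j)"

lemma weight_0 [simp]: "weight q a 0 = 1"
  by (simp add: weight_def)

lemma weight_Suc: "weight q a (Suc k) = weight q a k * (1 + (a - 1) / q ^ k)"
  by (simp add: weight_def)

lemma weight_Suc_shift: "weight q a (Suc k) = a * weight q (1 + (a - 1) / q) k"
  by (simp only: weight_def prod.lessThan_Suc_shift) simp

text \<open>One greedy step keeps each of the other available vertices independently with probability \<open>q\<close>. By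
  induction, the weight of the remaining run has conditional mean \<open>a' ^ j\<close> when \<open>j\<close> vertices survive,
  with \<open>a' = 1 + (a - 1) / q\<close>, and averaging over the binomial number \<open>j\<close> restores a power of \<open>a\<close>.
  The edge set \<open>D\<close> may be larger than needed so that the induction can pass to subsets of \<open>A\<close>.\<close>

lemma expectation_weight_steps:
  assumes "0 < q" "q \<le> 1" "finite D" "finite A" "card A \<le> m"
    and "\<And>u v. u \<in> A \<Longrightarrow> v \<in> A \<Longrightarrow> u \<noteq> v \<Longrightarrow> {u, v} \<in> D"
  shows "measure_pmf.expectation (coin_flips (1 - q) D)
    (\<lambda>f. measure_pmf.expectation (steps {e \<in> D. f e} m A) (weight q a)) = a ^ card A"
  using assms(3-)
proof (induction m arbitrary: A D a)
  case 0
  then show ?case by simp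
next
  case (Suc m)
  show ?case
  proof (cases "A = {}")
    case False
    define a' where "a' = 1 + (a - 1) / q"
    let ?E = "\<lambda>f. {e \<in> D. f e}"
    have int: "integrable (measure_pmf (coin_flips (1 - q) D)) h" for h :: "_ \<Rightarrow> real"
      by (intro integrable_measure_pmf_finite finite_coin_flips Suc.prems)
    have chosen: "measure_pmf.expectation (coin_flips (1 - q) D) (\<lambda>f. measure_pmf.expectation
        (steps (?E f) m (A - {v} - neighbours (?E f) v)) (weight q a')) = a ^ (card A - 1)"
      if v: "v \<in> A" for v
    proof -
      \<comment> \<open>The edges between \<open>v\<close> and the rest of \<open>A\<close> decide which vertices survive the step, and they are
        independent of the edges among the survivors, which alone drive the remaining run.\<close>
      define S where "S = (\<lambda>u. {u, v}) ` (A - {v})"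
      have S: "S \<subseteq> D" "finite S" using Suc.prems v by (auto simp: S_def)
      have inj: "inj_on (\<lambda>u. {u, v}) (A - {v})" by (auto simp: inj_on_def doubleton_eq_iff)
      have card_S: "card S = card A - 1"
        using Suc.prems(2) v by (simp add: S_def card_image[OF inj])
      define N where "N = (\<lambda>f. {u \<in> A - {v}. \<not> f {u, v}})"
      have card_N: "card (N f) = card {e \<in> S. \<not> f e}" for f
      proof -
        have "{e \<in> S. \<not> f e} = (\<lambda>u. {u, v}) ` N f" by (auto simp: S_def N_def)
        moreover have "inj_on (\<lambda>u. {u, v}) (N f)"
          using inj by (rule inj_on_subset) (auto simp: N_def)
        ultimately show ?thesis by (simp add: card_image)
      qed
      have N: "finite (N f)" "card (N f) \<le> m" "N f \<subseteq> A - {v}" for f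
      proof -
        show "N f \<subseteq> A - {v}" by (auto simp: N_def)
        then show "finite (N f)" using Suc.prems(2) by (auto intro: finite_subset)
        have "card (N f) \<le> card (A - {v})"
          using \<open>N f \<subseteq> A - {v}\<close> Suc.prems(2) by (intro card_mono) auto
        then show "card (N f) \<le> m" using Suc.prems(2,3) v by simp
      qed
      have split: "steps (?E h) m (A - {v} - neighbours (?E h) v) = steps {e \<in> D - S. g e} m (N f)"
        if h: "h = (\<lambda>e. if e \<in> S then f e else g e)" for f g h
      proof -
        have "A - {v} - neighbours (?E h) v = N f"
          using Suc.prems(4) v by (auto simp: neighbours_def N_def h S_def)
        moreover have "steps (?E h) m (N f) = steps {e \<in> D - S. g e} m (N f)"
        proof (rule steps_cong)
          fix u w assume "u \<in> N f" "w \<in> N f"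
          then have "{u, w} \<notin> S" using N(3)[of f] by (auto simp: S_def doubleton_eq_iff)
          then show "{u, w} \<in> ?E h \<longleftrightarrow> {u, w} \<in> {e \<in> D - S. g e}" by (auto simp: h)
        qed (rule N)
        ultimately show ?thesis by simp
      qed
      have "measure_pmf.expectation (coin_flips (1 - q) (S \<union> (D - S))) (\<lambda>f. measure_pmf.expectation
          (steps (?E f) m (A - {v} - neighbours (?E f) v)) (weight q a')) =
        measure_pmf.expectation (coin_flips (1 - q) S) (\<lambda>f.
          measure_pmf.expectation (coin_flips (1 - q) (D - S)) (\<lambda>g.
            measure_pmf.expectation (steps {e \<in> D - S. g e} m (N f)) (weight q a')))"
        using S Suc.prems(1)
        by (subst expectation_coin_flips_Un) (simp_all only: split[OF refl] finite_Diff Diff_disjoint)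
      also have "\<dots> = measure_pmf.expectation (coin_flips (1 - q) S) (\<lambda>f. a' ^ card (N f))"
      proof (intro Bochner_Integration.integral_cong refl Suc.IH)
        fix f u w assume "u \<in> N f" "w \<in> N f" "u \<noteq> w"
        then show "{u, w} \<in> D - S"
          using N(3)[of f] Suc.prems(4)[of u w] by (auto simp: S_def doubleton_eq_iff)
      qed (use N Suc.prems(1) in auto)
      also have "\<dots> = (1 - q + q * a') ^ card S"
        using S assms(1,2) by (simp add: card_N expectation_power_failures)
      \<comment> \<open>Each of the other vertices survives with probability \<open>q\<close> and then contributes a factor \<open>a'\<close>;
        the shift \<open>a \<mapsto> a'\<close> is exactly what makes the mean factor \<open>a\<close>.\<close>
      also have "1 - q + q * a' = a" using assms(1) by (simp add: a'_def field_simps)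
      finally show ?thesis using S(1) by (simp add: card_S Un_absorb1)
    qed
    have "measure_pmf.expectation (steps (?E f) (Suc m) A) (weight q a) =
        (\<Sum>v\<in>A. a / card A * measure_pmf.expectation
          (steps (?E f) m (A - {v} - neighbours (?E f) v)) (weight q a'))" for f
      using False Suc.prems(2)
      by (simp, subst pmf_expectation_bind[of A])
         (auto simp: finite_set_steps weight_Suc_shift a'_def)
    then have "measure_pmf.expectation (coin_flips (1 - q) D)
        (\<lambda>f. measure_pmf.expectation (steps (?E f) (Suc m) A) (weight q a)) =
        (\<Sum>v\<in>A. a / card A * a ^ (card A - 1))"
      using int by (simp add: chosen del: steps.simps)
    also have "\<dots> = a ^ card A"
      using False Suc.prems(2) by (cases "card A") auto
    finally show ?thesis .
  qed simp
qed

lemma expectation_weight_greedy_size: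
  assumes "0 < c" "c < real n"
  shows "measure_pmf.expectation (greedy_size c n) (weight (1 - c / real n) a) = a ^ n"
proof -
  have "measure_pmf.expectation (coin_flips (1 - (1 - c / real n)) (vertex_pairs n))
    (\<lambda>f. measure_pmf.expectation (steps {e \<in> vertex_pairs n. f e} n {1..n})
      (weight (1 - c / real n) a)) = a ^ card {1..n}"
    using assms
    by (intro expectation_weight_steps) (auto simp: finite_vertex_pairs, auto simp: vertex_pairs_def)
  then show ?thesis
    unfolding greedy_size_eq_steps
    by (subst expectation_bind_finite) (auto simp: finite_coin_flips finite_vertex_pairs finite_set_steps)
qed

section \<open>Sign and monotonicity of the weights\<close>

lemma weight_nonneg_ge1: "1 \<le> a \<Longrightarrow> 0 < q \<Longrightarrow> 0 \<le> weight q a k"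
  unfolding weight_def by (intro prod_nonneg) auto

text \<open>For \<open>a < 1\<close> the factors of the weight eventually become negative. If \<open>a = 1 - q ^ K\<close>, the factor with
  index \<open>K\<close> vanishes just before this happens, so the weight stops at zero and never changes sign.\<close>

lemma weight_nonneg_power:
  assumes "0 < q" "q \<le> 1"
  shows "0 \<le> weight q (1 - q ^ K) k"
proof (cases "k \<le> K")
  case True
  then show ?thesis
    unfolding weight_def using assms
    by (intro prod_nonneg) (auto simp: field_simps intro!: power_decreasing)
next
  case False
  then show ?thesis
    unfolding weight_def using assms by (subst prod_zero) (auto intro!: bexI[of _ K])
qed

text \<open>The ratio of two weights with parameters \<open>b \<le> g\<close> is monotone in the size. This allows the tilted mass
  beyond a point to be compared with the total mass for a different parameter.\<close>

lemma weight_ratio_mono: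
  assumes "b \<le> g" "0 < q" "\<And>k. 0 \<le> weight q b k" "\<And>k. 0 \<le> weight q g k" "k \<le> l"
  shows "weight q b l * weight q g k \<le> weight q g l * weight q b k"
  using assms(5)
proof (induction l rule: dec_induct)
  case (step l)
  let ?f = "\<lambda>a. 1 + (a - 1) / q ^ l"
  have fle: "?f b \<le> ?f g" using assms by (simp add: divide_right_mono)
  show ?case
  \<comment> \<open>A negative factor \<open>?f b\<close> can only follow a vanishing weight, since all weights are nonnegative.\<close>
  proof (cases "weight q b l = 0")
    case True
    then show ?thesis using assms(3,4) by (simp add: weight_Suc[of _ b] )
  next
    case False
    then have pos: "0 < weight q b l" using assms(3)[of l] by simp
    have "0 \<le> weight q b l * ?f b" using assms(3)[of "Suc l"] by (simp add: weight_Suc)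
    then have f: "0 \<le> ?f b" using pos by (simp add: zero_le_mult_iff)
    have "weight q b (Suc l) * weight q g k = ?f b * (weight q b l * weight q g k)"
      by (simp add: weight_Suc)
    also have "\<dots> \<le> ?f b * (weight q g l * weight q b k)"
      using f step.IH by (rule mult_left_mono[rotated])
    also have "\<dots> \<le> ?f g * (weight q g l * weight q b k)"
      using fle assms by (intro mult_right_mono mult_nonneg_nonneg) auto
    finally show ?thesis by (simp add: weight_Suc mult_ac)
  qed
qed (simp add: mult.commute)

lemma weight_mono:
  assumes "1 \<le> a" "0 < q" "k \<le> l"
  shows "weight q a k \<le> weight q a l"
  using assms(3)
proof (induction l rule: dec_induct)
  case (step l)
  have "weight q a l * 1 \<le> weight q a l * (1 + (a - 1) / q ^ l)"
    using assms by (intro mult_left_mono weight_nonneg_ge1) auto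
  with step.IH show ?case by (simp add: weight_Suc)
qed simp

lemma weight_antimono:
  assumes "a \<le> 1" "0 < q" "k \<le> l" "\<And>k. 0 \<le> weight q a k"
  shows "weight q a l \<le> weight q a k"
  using assms(3)
proof (induction l rule: dec_induct)
  case (step l)
  have "weight q a l * (1 + (a - 1) / q ^ l) \<le> weight q a l * 1"
    using assms by (intro mult_left_mono) (auto simp: divide_nonpos_pos)
  with step.IH show ?case by (simp add: weight_Suc)
qed simp

section \<open>Exponential growth rate of the weights\<close>

lemma eventually_gt_real: "\<forall>\<^sub>F n in sequentially. (c :: real) < real n"
  using eventually_gt_at_top[of "nat \<lceil>c\<rceil>"] by eventually_elim linarith

lemma power_one_minus_tendsto:
  fixes k :: "nat \<Rightarrow> nat"
  assumes "(\<lambda>n. real (k n) / real n) \<longlonglongrightarrow> x"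
  shows "(\<lambda>n. (1 - c / real n) ^ k n) \<longlonglongrightarrow> exp (- c * x)"
proof -
  have "(\<lambda>n. real n * ln (1 - c / real n)) \<longlonglongrightarrow> - c"
    by real_asymp
  then have "(\<lambda>n. exp ((real n * ln (1 - c / real n)) * (real (k n) / real n))) \<longlonglongrightarrow> exp (- c * x)"
    using assms by (intro tendsto_intros)
  moreover have "\<forall>\<^sub>F n in sequentially. exp ((real n * ln (1 - c / real n)) * (real (k n) / real n))
      = (1 - c / real n) ^ k n"
    using eventually_gt_at_top[of 0] eventually_gt_at_top[of "nat \<lceil>\<bar>c\<bar>\<rceil>"]
  proof eventually_elim
    case (elim n)
    then have "0 < 1 - c / real n" by (simp add: field_simps) linarith
    then show ?case using elim by (simp add: powr_realpow[symmetric] powr_def mult.commute)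
  qed
  ultimately show ?thesis by (rule Lim_transform_eventually)
qed

text \<open>Parameters converging to \<open>a\<close> for which the weights are nonnegative, so that they act as densities of a
  change of measure. For \<open>a < 1\<close> a constant sequence will not do in general.\<close>

definition admissible :: "real \<Rightarrow> (nat \<Rightarrow> real) \<Rightarrow> real \<Rightarrow> bool" where
  "admissible c \<alpha> a \<longleftrightarrow> \<alpha> \<longlonglongrightarrow> a \<and> (\<forall>\<^sub>F n in sequentially. \<forall>k. 0 \<le> weight (1 - c / real n) (\<alpha> n) k)"

lemma admissible_sequence_exists:
  fixes a c :: real
  assumes "0 < c" "0 < a"
  obtains \<alpha> where "admissible c \<alpha> a"
proof (cases "1 \<le> a")
  case True
  have "\<forall>\<^sub>F n in sequentially. \<forall>k. 0 \<le> weight (1 - c / real n) a k"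
    using eventually_gt_at_top[of "nat \<lceil>c\<rceil>"]
  proof eventually_elim
    case (elim n)
    then have "c < real n" by linarith
    then show ?case using True assms by (intro allI weight_nonneg_ge1) (auto simp: field_simps)
  qed
  then show ?thesis by (intro that[of "\<lambda>_. a"]) (simp add: admissible_def)
next
  case False
  \<comment> \<open>For \<open>a < 1\<close> the value \<open>a\<close> is replaced by some \<open>1 - q ^ K\<close> near it; \<open>q ^ K \<approx> exp (- c * K / n)\<close>
    dictates \<open>K \<approx> x * n\<close>.\<close>
  define x where "x = - ln (1 - a) / c"
  define K where "K n = nat \<lfloor>x * real n\<rfloor>" for n
  have "0 < x" using False assms by (simp add: x_def divide_pos_pos field_simps)
  then have "(\<lambda>n. real (K n) / real n) \<longlonglongrightarrow> x"
    unfolding K_def by real_asymp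
  then have "(\<lambda>n. 1 - (1 - c / real n) ^ K n) \<longlonglongrightarrow> 1 - exp (- c * x)"
    by (intro tendsto_intros power_one_minus_tendsto)
  also have "1 - exp (- c * x) = a" using False assms by (simp add: x_def)
  finally have "(\<lambda>n. 1 - (1 - c / real n) ^ K n) \<longlonglongrightarrow> a" .
  moreover have "\<forall>\<^sub>F n in sequentially. \<forall>k. 0 \<le> weight (1 - c / real n) (1 - (1 - c / real n) ^ K n) k"
    using eventually_gt_at_top[of "nat \<lceil>c\<rceil>"]
  proof eventually_elim
    case (elim n)
    then have "c < real n" by linarith
    then show ?case using assms by (intro allI weight_nonneg_power) (auto simp: field_simps)
  qed
  ultimately show ?thesis by (intro that) (simp add: admissible_def)
qed

text \<open>The exponential rate of the weights: divided by \<open>n\<close>, their logarithm is a Riemann sum of it.\<close>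

definition log_integral :: "real \<Rightarrow> real \<Rightarrow> real \<Rightarrow> real" where
  "log_integral c a x = (\<integral>y. indicator {0..<x} y * ln (1 + (a - 1) * exp (c * y)) \<partial>lborel)"

text \<open>Dominated convergence with a moving right end point; it gives both the Riemann sum limit and the joint
  continuity of \<open>log_integral\<close>.\<close>

lemma integral_moving_interval_tendsto:
  fixes g :: "nat \<Rightarrow> real \<Rightarrow> real"
  assumes [measurable]: "\<And>n. g n \<in> borel_measurable borel" "h \<in> borel_measurable borel"
    and x: "X \<longlonglongrightarrow> x"
    and lim: "\<And>y. 0 \<le> y \<Longrightarrow> y < x \<Longrightarrow> (\<lambda>n. g n y) \<longlonglongrightarrow> h y"
    and bound: "\<forall>\<^sub>F n in sequentially. \<forall>y. 0 \<le> y \<and> y < X n \<longrightarrow> \<bar>g n y\<bar> \<le> C"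
  shows "(\<lambda>n. \<integral>y. indicator {0..<X n} y * g n y \<partial>lborel) \<longlonglongrightarrow> (\<integral>y. indicator {0..<x} y * h y \<partial>lborel)"
proof -
  define good where "good n \<longleftrightarrow> X n < x + 1 \<and> (\<forall>y. 0 \<le> y \<and> y < X n \<longrightarrow> \<bar>g n y\<bar> \<le> C)" for n
  have ev: "\<forall>\<^sub>F n in sequentially. good n"
    using order_tendstoD(2)[OF x, of "x + 1"] bound by (auto simp: good_def eventually_conj_iff)
  \<comment> \<open>Setting the finitely many bad terms to zero makes the bound hold for all indices.\<close>
  define f where "f n y = (if good n then indicator {0..<X n} y * g n y else 0)" for n y
  have "(\<lambda>n. \<integral>y. f n y \<partial>lborel) \<longlonglongrightarrow> (\<integral>y. indicator {0..<x} y * h y \<partial>lborel)"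
  proof (rule integral_dominated_convergence)
    show "(\<lambda>y. indicator {0..<x} y * h y) \<in> borel_measurable lborel"
      by measurable
    show "f n \<in> borel_measurable lborel" for n
      unfolding f_def by measurable
    show "integrable lborel (\<lambda>y. indicator {0..x + 1} y * \<bar>C\<bar>)"
      by (intro integrable_mult_left) (simp add: integrable_indicator_iff emeasure_lborel_Icc_eq)
    show "AE y in lborel. norm (f n y) \<le> indicator {0..x + 1} y * \<bar>C\<bar>" for n
      by (auto simp: f_def good_def split: split_indicator intro!: AE_I2 intro: order_trans)
    have "AE y in lborel. y \<noteq> x" by (rule AE_lborel_singleton)
    then show "AE y in lborel. (\<lambda>n. f n y) \<longlonglongrightarrow> indicator {0..<x} y * h y"
    proof eventually_elim
      case (elim y)
      show ?case
      proof (cases "0 \<le> y \<and> y < x")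
        case True
        have "\<forall>\<^sub>F n in sequentially. g n y = f n y"
          using ev order_tendstoD(1)[OF x conjunct2[OF True]]
          by eventually_elim (use True in \<open>simp add: f_def\<close>)
        then show ?thesis using lim[of y] True by (auto intro: Lim_transform_eventually)
      next
        case False
        have "\<forall>\<^sub>F n in sequentially. f n y = 0"
        proof (cases "y < 0")
          case True
          then show ?thesis by (simp add: f_def)
        next
          case nonneg: False
          then have "x < y" using False elim by auto
          from order_tendstoD(2)[OF x this] show ?thesis
            by eventually_elim (simp add: f_def)
        qed
        then show ?thesis using False by (auto simp: tendsto_eventually)
      qed
    qed
  qed
  moreover have "\<forall>\<^sub>F n in sequentially. (\<integral>y. f n y \<partial>lborel) = (\<integral>y. indicator {0..<X n} y * g n y \<partial>lborel)"
    using ev by eventually_elim (simp add: f_def)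
  ultimately show ?thesis by (rule Lim_transform_eventually)
qed

lemma abs_ln_le_between:
  fixes t l u :: real
  assumes "0 < l" "min l u \<le> t" "t \<le> max l u" "0 < u"
  shows "\<bar>ln t\<bar> \<le> \<bar>ln l\<bar> + \<bar>ln u\<bar>"
proof -
  have "0 < t" using assms by linarith
  have "ln t \<le> max (ln l) (ln u)" "min (ln l) (ln u) \<le> ln t"
    using assms \<open>0 < t\<close> by (auto simp: min_def max_def split: if_splits)
  then show ?thesis by linarith
qed

text \<open>Affine functions are monotone; \<open>a\<close> is the value at \<open>z = 1\<close>.\<close>

lemma affine_between:
  fixes a z Z :: real
  assumes "1 \<le> z" "z \<le> Z"
  shows "min a (1 + (a - 1) * Z) \<le> 1 + (a - 1) * z" "1 + (a - 1) * z \<le> max a (1 + (a - 1) * Z)"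
proof -
  have between: "(a - 1) * 1 \<le> (a - 1) * z \<and> (a - 1) * z \<le> (a - 1) * Z \<or>
    (a - 1) * z \<le> (a - 1) * 1 \<and> (a - 1) * Z \<le> (a - 1) * z"
  proof (cases "0 \<le> a - 1")
    case True
    then show ?thesis using assms by (intro disjI1 conjI mult_left_mono) auto
  next
    case False
    then show ?thesis using assms by (intro disjI2 conjI mult_left_mono_neg) auto
  qed
  show "min a (1 + (a - 1) * Z) \<le> 1 + (a - 1) * z"
    using between by (elim disjE conjE) (simp_all only: min_le_iff_disj mult_1_right, argo+)
  show "1 + (a - 1) * z \<le> max a (1 + (a - 1) * Z)"
    using between by (elim disjE conjE) (simp_all only: le_max_iff_disj mult_1_right, argo+)
qed

lemma eventually_abs_ln_bounded:
  fixes \<alpha> \<beta> :: "nat \<Rightarrow> real"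
  assumes "\<alpha> \<longlonglongrightarrow> a" "\<beta> \<longlonglongrightarrow> b" "0 < a" "0 < b"
  shows "\<forall>\<^sub>F n in sequentially. 0 < \<alpha> n \<and> 0 < \<beta> n \<and> \<bar>ln (\<alpha> n)\<bar> + \<bar>ln (\<beta> n)\<bar> < \<bar>ln a\<bar> + \<bar>ln b\<bar> + 1"
proof -
  have "(\<lambda>n. \<bar>ln (\<alpha> n)\<bar> + \<bar>ln (\<beta> n)\<bar>) \<longlonglongrightarrow> \<bar>ln a\<bar> + \<bar>ln b\<bar>"
    using assms by (intro tendsto_intros) auto
  from order_tendstoD(2)[OF this, of "\<bar>ln a\<bar> + \<bar>ln b\<bar> + 1"]
    order_tendstoD(1)[OF assms(1,3)] order_tendstoD(1)[OF assms(2,4)]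
  show ?thesis by (intro eventually_conj) auto
qed

lemma log_integral_tendsto:
  assumes "\<alpha> \<longlonglongrightarrow> a" "X \<longlonglongrightarrow> x" "0 < a" "0 < 1 + (a - 1) * exp (c * x)" "0 < c"
  shows "(\<lambda>n. log_integral c (\<alpha> n) (X n)) \<longlonglongrightarrow> log_integral c a x"
  unfolding log_integral_def
proof (rule integral_moving_interval_tendsto)
  fix y assume "0 \<le> y" "y < x"
  then have "1 \<le> exp (c * y)" "exp (c * y) \<le> exp (c * x)" using assms by auto
  then have "0 < 1 + (a - 1) * exp (c * y)"
    using affine_between[of "exp (c * y)" "exp (c * x)" a] assms by linarith
  then show "(\<lambda>n. ln (1 + (\<alpha> n - 1) * exp (c * y))) \<longlonglongrightarrow> ln (1 + (a - 1) * exp (c * y))"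
    using assms by (intro tendsto_intros) auto
next
  have "(\<lambda>n. 1 + (\<alpha> n - 1) * exp (c * X n)) \<longlonglongrightarrow> 1 + (a - 1) * exp (c * x)"
    using assms by (intro tendsto_intros)
  from eventually_abs_ln_bounded[OF assms(1) this assms(3,4)]
  show "\<forall>\<^sub>F n in sequentially. \<forall>y. 0 \<le> y \<and> y < X n \<longrightarrow> \<bar>ln (1 + (\<alpha> n - 1) * exp (c * y))\<bar>
      \<le> \<bar>ln a\<bar> + \<bar>ln (1 + (a - 1) * exp (c * x))\<bar> + 1"
  proof eventually_elim
    case (elim n)
    show ?case
    proof (intro allI impI)
      fix y assume y: "0 \<le> y \<and> y < X n"
      then have "1 \<le> exp (c * y)" "exp (c * y) \<le> exp (c * X n)" using assms by auto
      from abs_ln_le_between[OF _ affine_between[OF this, of "\<alpha> n"]] elim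
      show "\<bar>ln (1 + (\<alpha> n - 1) * exp (c * y))\<bar> \<le> \<bar>ln a\<bar> + \<bar>ln (1 + (a - 1) * exp (c * x))\<bar> + 1"
        by force
    qed
  qed
qed (use assms in auto)

lemma integral_step_function:
  fixes f :: "nat \<Rightarrow> real"
  assumes "0 < n"
  shows "(\<integral>y. indicator {0..<real k / real n} y * f (nat \<lfloor>y * real n\<rfloor>) \<partial>lborel) = (\<Sum>j<k. f j) / real n
    \<and> integrable lborel (\<lambda>y. indicator {0..<real k / real n} y * f (nat \<lfloor>y * real n\<rfloor>))"
proof (induction k)
  case (Suc k)
  let ?g = "\<lambda>k y. indicator {0..<real k / real n} y * f (nat \<lfloor>y * real n\<rfloor>)"
  let ?I = "{real k / real n..<real (Suc k) / real n}"
  have "?g (Suc k) y = ?g k y + indicator ?I y * f k" for y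
  proof (cases "y \<in> ?I")
    case True
    then have "real k \<le> y * real n" "y * real n < real k + 1" using assms by (auto simp: field_simps)
    then have "\<lfloor>y * real n\<rfloor> = int k" by linarith
    moreover have "0 \<le> y" using True by (auto intro: order_trans[of _ "real k / real n"])
    ultimately show ?thesis using True by simp
  next
    case False
    moreover have "real k / real n \<le> real (Suc k) / real n" by (simp add: divide_right_mono)
    ultimately show ?thesis by (auto split: split_indicator)
  qed
  then have eq: "?g (Suc k) = (\<lambda>y. ?g k y + indicator ?I y * f k)" by auto
  have int: "integrable lborel (\<lambda>y. indicator ?I y * f k)"
    by (intro integrable_mult_left) (simp add: integrable_indicator_iff divide_right_mono)
  have "(\<integral>y. indicator ?I y * f k \<partial>lborel) = f k / real n"
    using assms by (simp add: divide_right_mono measure_def diff_divide_distrib[symmetric])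
  then show ?case unfolding eq using Suc.IH int by (simp add: add_divide_distrib)
qed simp

text \<open>All factors of the weight lie between the first, \<open>\<alpha> n\<close>, and the one with index \<open>k n\<close>, and both of these have
  positive limits. Hence the logarithms are uniformly bounded and dominated convergence applies.\<close>

lemma ln_weight_tendsto:
  fixes k :: "nat \<Rightarrow> nat"
  assumes \<alpha>: "\<alpha> \<longlonglongrightarrow> a" and k: "(\<lambda>n. real (k n) / real n) \<longlonglongrightarrow> x"
    and a: "0 < a" "0 < 1 + (a - 1) * exp (c * x)" and c: "0 < c"
  shows "\<forall>\<^sub>F n in sequentially. 0 < weight (1 - c / real n) (\<alpha> n) (k n)"
    and "(\<lambda>n. ln (weight (1 - c / real n) (\<alpha> n) (k n)) / real n) \<longlonglongrightarrow> log_integral c a x"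
proof -
  define q where "q n = 1 - c / real n" for n
  define f where "f n j = 1 + (\<alpha> n - 1) / q n ^ j" for n j
  define C where "C = \<bar>ln a\<bar> + \<bar>ln (1 + (a - 1) * exp (c * x))\<bar> + 1"
  have q: "\<forall>\<^sub>F n in sequentially. 0 < n \<and> 0 < q n \<and> q n \<le> 1"
    using eventually_gt_at_top[of "nat \<lceil>c\<rceil>"]
  proof eventually_elim
    case (elim n)
    then have "c < real n" by linarith
    then show ?case using c by (auto simp: q_def field_simps)
  qed
  have f_lim: "(\<lambda>n. f n (j n)) \<longlonglongrightarrow> 1 + (a - 1) * exp (c * y)"
    if "(\<lambda>n. real (j n) / real n) \<longlonglongrightarrow> y" for j y
  proof -
    have "(\<lambda>n. f n (j n)) \<longlonglongrightarrow> 1 + (a - 1) / exp (- c * y)"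
      unfolding f_def q_def using \<alpha> power_one_minus_tendsto[OF that] by (intro tendsto_intros) auto
    then show ?thesis by (simp add: exp_minus field_simps)
  qed
  have f_bound: "\<forall>\<^sub>F n in sequentially. \<forall>j\<le>k n. 0 < f n j \<and> \<bar>ln (f n j)\<bar> \<le> C"
    using q eventually_abs_ln_bounded[OF \<alpha> f_lim[OF k] a]
  proof eventually_elim
    case (elim n)
    show ?case
    proof (intro allI impI)
      fix j assume j: "j \<le> k n"
      have "1 \<le> 1 / q n ^ j" "1 / q n ^ j \<le> 1 / q n ^ k n"
        using elim j by (auto simp: power_le_one power_decreasing intro!: divide_left_mono)
      from affine_between[OF this, of "\<alpha> n"]
      have *: "min (\<alpha> n) (f n (k n)) \<le> f n j" "f n j \<le> max (\<alpha> n) (f n (k n))"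
        by (auto simp: f_def)
      then have "0 < f n j" using elim by linarith
      then show "0 < f n j \<and> \<bar>ln (f n j)\<bar> \<le> C"
        using abs_ln_le_between[OF _ *] elim by (auto simp: C_def)
    qed
  qed
  show "\<forall>\<^sub>F n in sequentially. 0 < weight (1 - c / real n) (\<alpha> n) (k n)"
    using f_bound
  proof eventually_elim
    case (elim n)
    then have "0 < (\<Prod>j<k n. f n j)" by (intro prod_pos) auto
    then show ?case by (simp add: weight_def f_def q_def)
  qed
  \<comment> \<open>The Riemann sum is the integral of the step function \<open>?F\<close>.\<close>
  let ?F = "\<lambda>n y. ln (f n (nat \<lfloor>y * real n\<rfloor>))"
  have "(\<lambda>n. \<integral>y. indicator {0..<real (k n) / real n} y * ?F n y \<partial>lborel) \<longlonglongrightarrow> log_integral c a x"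
    unfolding log_integral_def
  proof (rule integral_moving_interval_tendsto)
    fix y assume y: "0 \<le> y" "y < x"
    have "(\<lambda>n. real (nat \<lfloor>y * real n\<rfloor>) / real n) \<longlonglongrightarrow> y"
      using y by (cases "y = 0") (simp, real_asymp)
    note lim = f_lim[OF this]
    have "1 \<le> exp (c * y)" "exp (c * y) \<le> exp (c * x)" using y c by auto
    then have "0 < 1 + (a - 1) * exp (c * y)"
      using affine_between[of "exp (c * y)" "exp (c * x)" a] a by linarith
    then show "(\<lambda>n. ?F n y) \<longlonglongrightarrow> ln (1 + (a - 1) * exp (c * y))"
      using lim by (intro tendsto_ln) auto
  next
    show "\<forall>\<^sub>F n in sequentially. \<forall>y. 0 \<le> y \<and> y < real (k n) / real n \<longrightarrow> \<bar>?F n y\<bar> \<le> C"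
      using q f_bound
    proof eventually_elim
      case (elim n)
      show ?case
      proof (intro allI impI)
        fix y assume y: "0 \<le> y \<and> y < real (k n) / real n"
        then have "y * real n < real (k n)" using elim by (simp add: field_simps)
        then have "nat \<lfloor>y * real n\<rfloor> \<le> k n" by linarith
        then show "\<bar>?F n y\<bar> \<le> C" using elim by auto
      qed
    qed
  qed (use k in auto)
  moreover have "\<forall>\<^sub>F n in sequentially. (\<integral>y. indicator {0..<real (k n) / real n} y * ?F n y \<partial>lborel) =
      ln (weight (1 - c / real n) (\<alpha> n) (k n)) / real n"
    using q f_bound
  proof eventually_elim
    case (elim n)
    have "ln (\<Prod>j<k n. f n j) = (\<Sum>j<k n. ln (f n j))"
      using elim by (intro ln_prod) (auto simp: less_imp_neq[symmetric])
    then show ?case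
      using integral_step_function[of n "k n" "\<lambda>j. ln (f n j)"] elim
      by (simp add: weight_def f_def q_def)
  qed
  ultimately show "(\<lambda>n. ln (weight (1 - c / real n) (\<alpha> n) (k n)) / real n) \<longlonglongrightarrow> log_integral c a x"
    by (rule Lim_transform_eventually)
qed

section \<open>The equation relating the size and the parameter\<close>

text \<open>The right-hand side of the equation relating \<open>s\<close> and \<open>a\<close>: under the weight with parameter \<open>a\<close>, the size
  concentrates near this multiple of \<open>n\<close>.\<close>

definition profile_point :: "real \<Rightarrow> real \<Rightarrow> real" where
  "profile_point c a = 1 / c * ln ((b_of c a - 1) / (a - 1))"

lemma b_of_pos: "0 < a \<Longrightarrow> 0 < b_of c a"
  by (simp add: b_of_def)

lemma b_of_1 [simp]: "b_of c 1 = 1"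
  by (simp add: b_of_def)

lemma profile_ratio_pos:
  assumes "0 < c" "0 < a" "a \<noteq> 1"
  shows "0 < (b_of c a - 1) / (a - 1)"
proof (cases "1 < a")
  case True
  then have "0 < c * (1 - 1 / a)" using assms by (intro mult_pos_pos) (auto simp: field_simps)
  then have "1 < exp (c * (1 - 1 / a))" by simp
  then have "1 * 1 < a * exp (c * (1 - 1 / a))" using True by (intro mult_strict_mono) auto
  then show ?thesis using True by (simp add: b_of_def)
next
  case False
  then have "c * (1 - 1 / a) < 0" using assms by (intro mult_pos_neg) (auto simp: field_simps)
  then have "exp (c * (1 - 1 / a)) < 1" by simp
  then have "a * exp (c * (1 - 1 / a)) < 1 * 1" using False assms by (intro mult_strict_mono) auto
  then show ?thesis using False assms by (simp add: b_of_def divide_neg_neg)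
qed

lemma exp_profile_point:
  assumes "0 < c" "0 < a" "a \<noteq> 1"
  shows "1 + (a - 1) * exp (c * profile_point c a) = b_of c a"
  using profile_ratio_pos[OF assms] assms by (simp add: profile_point_def)

text \<open>Solving for \<open>a\<close> means intersecting the graph of \<open>b_of c\<close> with a line of slope \<open>exp (c * s)\<close> through the
  point \<open>(1, 1)\<close>, which itself lies on the graph.\<close>

lemma profile_point_eq_iff:
  assumes "0 < c" "0 < a" "a \<noteq> 1"
  shows "s = profile_point c a \<longleftrightarrow> 1 + (a - 1) * exp (c * s) = b_of c a"
proof
  assume "1 + (a - 1) * exp (c * s) = b_of c a"
  then have "(b_of c a - 1) / (a - 1) = exp (c * s)" using assms by (simp add: field_simps)
  then show "s = profile_point c a" using assms by (simp add: profile_point_def)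
qed (use exp_profile_point[OF assms] in simp)

text \<open>Strict convexity of \<open>b_of c\<close>, from its positive second derivative.\<close>

lemma b_of_three_slopes:
  assumes "0 < c" "0 < x" "x < y" "y < z"
  shows "(b_of c y - b_of c x) * (z - y) < (b_of c z - b_of c y) * (y - x)"
proof -
  define b' where "b' a = exp (c * (1 - 1 / a)) * (1 + c / a)" for a
  have deriv: "(b_of c has_real_derivative b' a) (at a)" if "0 < a" for a
    unfolding b_of_def b'_def using that
    by (auto intro!: derivative_eq_intros simp: field_simps power2_eq_square)
  have deriv': "(b' has_real_derivative exp (c * (1 - 1 / a)) * (c\<^sup>2 / a ^ 3)) (at a)" if "0 < a" for a
    unfolding b'_def using that
    by (auto intro!: derivative_eq_intros simp: field_simps power2_eq_square power3_eq_cube)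
  have mono: "b' u < b' v" if "0 < u" "u < v" for u v
  proof (rule DERIV_pos_imp_increasing[OF that(2)])
    fix a assume "u \<le> a" "a \<le> v"
    then show "\<exists>D. (b' has_real_derivative D) (at a) \<and> 0 < D"
      using deriv'[of a] that assms(1)
      by (intro exI[of _ "exp (c * (1 - 1 / a)) * (c\<^sup>2 / a ^ 3)"] conjI) auto
  qed
  obtain u where u: "x < u" "u < y" "b_of c y - b_of c x = (y - x) * b' u"
    using MVT2[OF assms(3), of "b_of c" b'] deriv assms by force
  obtain v where v: "y < v" "v < z" "b_of c z - b_of c y = (z - y) * b' v"
    using MVT2[OF assms(4), of "b_of c" b'] deriv assms by force
  have "b' u * ((y - x) * (z - y)) < b' v * ((y - x) * (z - y))"
    using mono[of u v] u v assms by (intro mult_strict_right_mono) auto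
  then show ?thesis using u v by (simp add: mult_ac)
qed

text \<open>A strictly convex function lies strictly above a secant line outside the two intersection points.\<close>

lemma b_of_above_secant:
  assumes "0 < c" "0 < p" "0 < r" "0 < t" "b_of c p = 1 + (p - 1) * E" "b_of c r = 1 + (r - 1) * E"
    and "p < r" "t < p \<or> r < t"
  shows "1 + (t - 1) * E < b_of c t"
proof -
  have secant: "b_of c r - b_of c p = (r - p) * E"
    using assms(5,6) by (simp add: algebra_simps)
  show ?thesis using assms(8)
  proof
    assume "t < p"
    from b_of_three_slopes[OF assms(1,4) this assms(7)]
    have "(b_of c p - b_of c t) * (r - p) < ((p - t) * E) * (r - p)"
      unfolding secant by (simp add: mult_ac)
    then have "b_of c p - b_of c t < (p - t) * E"
      using assms(7) by (auto dest: mult_right_less_imp_less)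
    then show ?thesis using assms(5) by (simp add: algebra_simps)
  next
    assume "r < t"
    from b_of_three_slopes[OF assms(1,2,7) this]
    have "((t - r) * E) * (r - p) < (b_of c t - b_of c r) * (r - p)"
      unfolding secant by (simp add: mult_ac)
    then have "(t - r) * E < b_of c t - b_of c r"
      using assms(7) by (auto dest: mult_right_less_imp_less)
    then show ?thesis using assms(6) by (simp add: algebra_simps)
  qed
qed

text \<open>A line meets the graph of a strictly convex function at most twice, and one of the intersections is at \<open>1\<close>.\<close>

lemma profile_point_inj:
  assumes "0 < c" "0 < a" "a \<noteq> 1" "0 < a'" "a' \<noteq> 1" "profile_point c a = profile_point c a'"
  shows "a = a'"
proof (rule ccontr)
  assume "a \<noteq> a'"
  define E where "E = exp (c * profile_point c a)"
  have "\<forall>t\<in>{1, a, a'}. 0 < t \<and> b_of c t = 1 + (t - 1) * E"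
    using assms exp_profile_point[OF assms(1-3)] exp_profile_point[OF assms(1,4,5)] by (auto simp: E_def)
  moreover have "\<exists>p\<in>{1, a, a'}. \<exists>r\<in>{1, a, a'}. \<exists>t\<in>{1, a, a'}. p < r \<and> r < t"
    using \<open>a \<noteq> a'\<close> assms(3,5) by (auto simp: neq_iff)
  ultimately show False using b_of_above_secant[OF assms(1)] by (metis less_irrefl)
qed

lemma profile_point_above:
  assumes "0 < c" "1 < a" "a < a'"
  shows "profile_point c a < profile_point c a'"
proof -
  have "1 + (a' - 1) * exp (c * profile_point c a) < b_of c a'"
    using assms exp_profile_point[of c a]
    by (intro b_of_above_secant[of c 1 a a' "exp (c * profile_point c a)"]) auto
  also have "\<dots> = 1 + (a' - 1) * exp (c * profile_point c a')"
    using assms exp_profile_point[of c a'] by simp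
  finally show ?thesis using assms by (simp add: mult_less_cancel_left)
qed

lemma profile_point_below:
  assumes "0 < c" "0 < a'" "a' < a" "a < 1"
  shows "profile_point c a' < profile_point c a"
proof -
  have "1 + (a' - 1) * exp (c * profile_point c a) < b_of c a'"
    using assms exp_profile_point[of c a]
    by (intro b_of_above_secant[of c a 1 a' "exp (c * profile_point c a)"]) auto
  also have "\<dots> = 1 + (a' - 1) * exp (c * profile_point c a')"
    using assms exp_profile_point[of c a'] by simp
  finally show ?thesis using assms by (simp add: mult_less_cancel_left)
qed

lemma isCont_b_of: "0 < a \<Longrightarrow> isCont (b_of c) a"
  unfolding b_of_def by (intro continuous_intros) auto

text \<open>The line through \<open>(1, 1)\<close> of slope \<open>exp (c * s)\<close> is steeper than the tangent, whose slope is \<open>1 + c\<close>,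
  exactly when \<open>s > s_crit c\<close>; it then rises above the convex graph to the right of \<open>1\<close>, and because
  \<open>s < 1\<close> it is overtaken again later.\<close>

lemma profile_point_surj_above:
  assumes "0 < c" "s_crit c < s" "s < 1"
  obtains a where "1 < a" "profile_point c a = s"
proof -
  define G where "G a = 1 + (a - 1) * exp (c * s) - b_of c a" for a
  have isCont_G: "isCont G a" if "0 < a" for a
    unfolding G_def using that by (intro continuous_intros isCont_b_of)
  have deriv: "(G has_real_derivative exp (c * s) - (1 + c)) (at 1)"
    unfolding G_def b_of_def by (auto intro!: derivative_eq_intros)
  have "ln (1 + c) < c * s" using assms by (simp add: s_crit_def field_simps)
  then have "1 + c < exp (c * s)" using assms exp_less_cancel_iff[of "ln (1 + c)" "c * s"] by simp
  with DERIV_pos_inc_right[OF deriv] obtain d where d: "0 < d" "\<And>h. 0 < h \<Longrightarrow> h < d \<Longrightarrow> G 1 < G (1 + h)"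
    by auto
  \<comment> \<open>Since \<open>G' 1 > 0\<close>, the gap \<open>G\<close> is positive slightly to the right of its zero \<open>1\<close>.\<close>
  define a1 where "a1 = 1 + d / 2"
  have a1: "1 < a1" "0 < G a1" using d(2)[of "d / 2"] d(1) by (auto simp: a1_def G_def)
  have gap: "0 < exp c - exp (c * s)" using assms by simp
  \<comment> \<open>From \<open>exp (- c / a) \<ge> 1 - c / a\<close> one gets \<open>b_of c a \<ge> exp c * (a - c)\<close>, which beats the line
    \<open>1 + (a - 1) * exp (c * s)\<close> from this point on.\<close>
  define a2 where "a2 = max a1 ((1 + c * exp c) / (exp c - exp (c * s)))"
  have a2: "1 < a2" using a1 by (simp add: a2_def)
  have "1 + c * exp c \<le> a2 * (exp c - exp (c * s))"
    using gap by (simp add: a2_def pos_divide_le_eq[symmetric])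
  moreover have "exp c * (a2 - c) \<le> b_of c a2"
  proof -
    have "a2 * exp c * (1 + (- c / a2)) \<le> a2 * exp c * exp (- c / a2)"
      using a2 by (intro mult_left_mono exp_ge_add_one_self) auto
    also have "a2 * exp c * exp (- c / a2) = b_of c a2"
      by (simp add: b_of_def right_diff_distrib exp_diff exp_minus divide_inverse)
    also have "a2 * exp c * (1 + (- c / a2)) = exp c * (a2 - c)"
      using a2 by (simp add: field_simps)
    finally show ?thesis .
  qed
  ultimately have "G a2 \<le> 0" unfolding G_def by (simp add: algebra_simps)
      (smt (verit) exp_gt_zero)
  moreover have "a1 \<le> a2" by (simp add: a2_def)
  ultimately obtain a where a: "a1 \<le> a" "a \<le> a2" "G a = 0"
    using IVT2[of G a2 0 a1] a1 isCont_G by force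
  then have "1 < a" using a1 by simp
  moreover have "profile_point c a = s"
    using profile_point_eq_iff[of c a s] a(3) \<open>1 < a\<close> assms(1) by (simp add: G_def)
  ultimately show ?thesis by (rule that)
qed

text \<open>Below the critical value the line is flatter than the tangent, and the second intersection lies to the
  left of \<open>1\<close>.\<close>

lemma profile_point_surj_below:
  assumes "0 < c" "0 < s" "s < s_crit c"
  obtains a where "0 < a" "a < 1" "profile_point c a = s"
proof -
  define G where "G a = 1 + (a - 1) * exp (c * s) - b_of c a" for a
  have isCont_G: "isCont G a" if "0 < a" for a
    unfolding G_def using that by (intro continuous_intros isCont_b_of)
  have deriv: "(G has_real_derivative exp (c * s) - (1 + c)) (at 1)"
    unfolding G_def b_of_def by (auto intro!: derivative_eq_intros)
  have "c * s < ln (1 + c)" using assms by (simp add: s_crit_def field_simps)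
  then have "exp (c * s) < 1 + c" using assms exp_less_cancel_iff[of "c * s" "ln (1 + c)"] by simp
  with DERIV_neg_dec_left[OF deriv] obtain d where d: "0 < d" "\<And>h. 0 < h \<Longrightarrow> h < d \<Longrightarrow> G 1 < G (1 - h)"
    by auto
  define h where "h = min (d / 2) (1 / 2)"
  define a1 where "a1 = 1 - h"
  have a1: "0 < a1" "a1 < 1" "0 < G a1" using d(2)[of h] d(1) by (auto simp: a1_def G_def h_def)
  \<comment> \<open>At \<open>a0\<close> the line \<open>1 + (a - 1) * exp (c * s)\<close> crosses zero while \<open>b_of c\<close> is positive.\<close>
  define a0 where "a0 = 1 - exp (- c * s)"
  have a0: "0 < a0" "a0 < 1" using assms by (auto simp: a0_def)
  have a0_eq: "1 + (a0 - 1) * exp (c * s) = 0" by (simp add: a0_def exp_minus)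
  then have "G a0 < 0" using b_of_pos[OF a0(1), of c] by (simp add: G_def)
  moreover have "a0 < a1"
  proof (rule ccontr)
    assume "\<not> a0 < a1"
    then have "1 + (a1 - 1) * exp (c * s) \<le> 1 + (a0 - 1) * exp (c * s)"
      by (intro add_left_mono mult_right_mono) auto
    then show False using a1 a0_eq b_of_pos[OF a1(1), of c] by (simp add: G_def)
  qed
  ultimately obtain a where a: "a0 \<le> a" "a \<le> a1" "G a = 0"
    using IVT[of G a0 0 a1] a1 a0 isCont_G by force
  then have "0 < a" "a < 1" using a1 a0 by auto
  moreover have "profile_point c a = s"
    using profile_point_eq_iff[of c a s] a(3) \<open>0 < a\<close> \<open>a < 1\<close> assms(1) by (simp add: G_def)
  ultimately show ?thesis by (rule that)
qed

lemma profile_parameter_exists: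
  assumes "0 < c" "0 < s" "s < 1" "s \<noteq> s_crit c"
  obtains a where "0 < a" "a \<noteq> 1" "profile_point c a = s" "1 < a \<longleftrightarrow> s_crit c < s"
proof (cases "s_crit c < s")
  case True
  obtain a where "1 < a" "profile_point c a = s"
    using profile_point_surj_above[OF assms(1) True assms(3)] .
  then show ?thesis using True by (intro that[of a]) auto
next
  case False
  then have "s < s_crit c" using assms(4) by simp
  then obtain a where "0 < a" "a < 1" "profile_point c a = s"
    using profile_point_surj_below[OF assms(1,2)] by metis
  then show ?thesis using False by (intro that[of a]) auto
qed

section \<open>The exponent and its dependence on the parameter\<close>

text \<open>The exponential rate of the bound \<open>a ^ n / weight q a k\<close> for \<open>k \<approx> x * n\<close>.\<close>

definition exponent :: "real \<Rightarrow> real \<Rightarrow> real \<Rightarrow> real" where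
  "exponent c a x = ln a - log_integral c a x"

lemma affine_exp_pos:
  fixes a c x y :: real
  assumes "0 < a" "0 < 1 + (a - 1) * exp (c * x)" "0 \<le> y" "y \<le> x" "0 < c"
  shows "0 < 1 + (a - 1) * exp (c * y)"
proof -
  have "1 \<le> exp (c * y)" "exp (c * y) \<le> exp (c * x)" using assms by auto
  from affine_between(1)[OF this, of a] show ?thesis using assms by linarith
qed

lemma continuous_on_ln_affine_exp:
  fixes a c x :: real
  assumes "0 < a" "0 < 1 + (a - 1) * exp (c * x)" "0 < c"
  shows "continuous_on {0..x} (\<lambda>y. ln (1 + (a - 1) * exp (c * y)))"
  using affine_exp_pos[of a c x] assms
  by (intro continuous_intros) (auto simp: less_imp_neq[symmetric])

lemma log_integral_interval:
  assumes "0 \<le> x"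
  shows "log_integral c a x = (LBINT y=ereal 0..ereal x. ln (1 + (a - 1) * exp (c * y)))"
  using assms by (subst interval_integral_Ico) (auto simp: log_integral_def set_lebesgue_integral_def)

lemma log_integral_eq_integral:
  assumes "0 < a" "0 < 1 + (a - 1) * exp (c * x)" "0 < c" "0 \<le> x"
  shows "log_integral c a x = integral {0..x} (\<lambda>y. ln (1 + (a - 1) * exp (c * y)))"
  unfolding log_integral_interval[OF assms(4)] using assms
  by (intro interval_integral_eq_integral borel_integrable_atLeastAtMost' continuous_on_ln_affine_exp) auto

text \<open>A one-sided version of differentiating the exponent with respect to \<open>a\<close>. The bracket
  tends to the derivative as \<open>a'\<close> approaches \<open>a\<close>.\<close>

lemma exponent_diff_le:
  assumes "0 < a" "0 < a'" "a' \<noteq> 1" "0 < c" "0 \<le> x"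
    and "0 < 1 + (a - 1) * exp (c * x)" "0 < 1 + (a' - 1) * exp (c * x)"
  shows "exponent c a' x - exponent c a x
    \<le> (a' - a) * (1 / a - ln ((1 + (a' - 1) * exp (c * x)) / a') / (c * (a' - 1)))"
proof -
  define B where "B a y = 1 + (a - 1) * exp (c * y)" for a y
  have pos: "0 < B a y" "0 < B a' y" if "y \<in> {0..x}" for y
    using affine_exp_pos[of a c x y] affine_exp_pos[of a' c x y] assms that
    by (auto simp: B_def)
  have cont: "continuous_on {0..x} (\<lambda>y. ln (B a y))" "continuous_on {0..x} (\<lambda>y. ln (B a' y))"
    unfolding B_def using assms by (auto intro!: continuous_on_ln_affine_exp)
  have FTC: "((\<lambda>y. (a' - a) * exp (c * y) / B a' y) has_integral
      (a' - a) / (c * (a' - 1)) * ln (B a' x) - (a' - a) / (c * (a' - 1)) * ln (B a' 0)) {0..x}"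
  proof (rule fundamental_theorem_of_calculus[OF assms(5)])
    fix y assume "y \<in> {0..x}"
    then have "((\<lambda>y. (a' - a) / (c * (a' - 1)) * ln (B a' y)) has_real_derivative
        (a' - a) * exp (c * y) / B a' y) (at y within {0..x})"
      unfolding B_def using pos(2)[of y, unfolded B_def] assms
      by (auto intro!: derivative_eq_intros simp: divide_simps)
    then show "((\<lambda>y. (a' - a) / (c * (a' - 1)) * ln (B a' y)) has_vector_derivative
        (a' - a) * exp (c * y) / B a' y) (at y within {0..x})"
      by (simp add: has_real_derivative_iff_has_vector_derivative)
  qed
  have collect: "k / d * u - k / d * v = k * ((u - v) / d)" for k d u v :: real
    by (cases "d = 0") (auto simp: field_simps)
  have "(a' - a) / (c * (a' - 1)) * ln (B a' x) - (a' - a) / (c * (a' - 1)) * ln (B a' 0)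
      = integral {0..x} (\<lambda>y. (a' - a) * exp (c * y) / B a' y)"
    using FTC by (simp add: integral_unique)
  also have "\<dots> \<le> integral {0..x} (\<lambda>y. ln (B a' y) - ln (B a y))"
  proof (rule integral_le)
    show "(\<lambda>y. ln (B a' y) - ln (B a y)) integrable_on {0..x}"
      using cont by (intro integrable_continuous_real continuous_on_diff)
    fix y assume y: "y \<in> {0..x}"
    \<comment> \<open>With \<open>ln z \<le> z - 1\<close> the logarithm is replaced by an integrand that has a primitive.\<close>
    have "ln (B a y / B a' y) \<le> B a y / B a' y - 1" using pos[OF y] by (intro ln_le_minus_one) auto
    also have "B a y / B a' y - 1 = - ((a' - a) * exp (c * y) / B a' y)"
      using pos[OF y] by (simp add: field_simps) (simp add: B_def algebra_simps)
    finally show "(a' - a) * exp (c * y) / B a' y \<le> ln (B a' y) - ln (B a y)"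
      using pos[OF y] by (simp add: ln_div)
  qed (use FTC in auto)
  also have "\<dots> = log_integral c a' x - log_integral c a x"
    using cont assms
    by (subst integral_diff) (auto simp: log_integral_eq_integral B_def intro!: integrable_continuous_real)
  also have "(a' - a) / (c * (a' - 1)) * ln (B a' x) - (a' - a) / (c * (a' - 1)) * ln (B a' 0) =
      (a' - a) * ((ln (B a' x) - ln (B a' 0)) / (c * (a' - 1)))"
    by (rule collect)
  also have "ln (B a' x) - ln (B a' 0) = ln (B a' x / a')"
    using pos[of x] assms by (simp add: ln_div) (simp add: B_def)
  finally have "(a' - a) * (ln (B a' x / a') / (c * (a' - 1))) \<le> log_integral c a' x - log_integral c a x" .
  moreover have "ln a' - ln a \<le> (a' - a) * (1 / a)"
    using ln_le_minus_one[of "a' / a"] assms by (simp add: ln_div field_simps)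
  ultimately show ?thesis unfolding exponent_def B_def by (simp add: right_diff_distrib)
qed

text \<open>The value \<open>\<kappa> a\<close>, which is the derivative of the exponent with respect to \<open>a\<close>, vanishes at \<open>x = profile_point c a\<close> by the definition
  of \<open>b_of\<close>, and on either side of this point its sign follows by comparing \<open>1 + (a - 1) * exp (c * x)\<close>
  with \<open>b_of c a\<close>.\<close>

lemma exponent_slope:
  assumes "0 < a" "a \<noteq> 1" "0 < c" "0 < 1 + (a - 1) * exp (c * x)"
  defines "\<kappa> \<equiv> \<lambda>a'. 1 / a - ln ((1 + (a' - 1) * exp (c * x)) / a') / (c * (a' - 1))"
  shows "isCont \<kappa> a" "profile_point c a < x \<Longrightarrow> \<kappa> a < 0" "x < profile_point c a \<Longrightarrow> 0 < \<kappa> a"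
proof -
  show "isCont \<kappa> a"
    unfolding \<kappa>_def using assms by (intro continuous_intros) auto
  define B where "B = 1 + (a - 1) * exp (c * x)"
  have b: "ln (b_of c a / a) = c * (1 - 1 / a)" using assms by (simp add: b_of_def)
  have eq: "\<kappa> a = (ln (b_of c a / a) - ln (B / a)) / (c * (a - 1))"
    unfolding b \<kappa>_def B_def using assms by (simp add: divide_simps)
  have b_eq: "b_of c a - B = (a - 1) * (exp (c * profile_point c a) - exp (c * x))"
    using exp_profile_point[OF assms(3,1,2)] by (simp add: B_def algebra_simps)
  have B: "0 < B" using assms by (simp add: B_def)
  have ln_less_iff: "ln (u / a) < ln (v / a) \<longleftrightarrow> u < v" if "0 < u" "0 < v" for u v
    using that assms(1) by (simp add: divide_less_cancel)
  note ln_iffs = ln_less_iff[OF B b_of_pos[OF assms(1)], of c] ln_less_iff[OF b_of_pos[OF assms(1)] B, of c]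
  show "\<kappa> a < 0" if "profile_point c a < x"
  proof -
    have *: "exp (c * profile_point c a) - exp (c * x) < 0" using that assms by simp
    show ?thesis
    proof (cases "1 < a")
      case True
      then have "b_of c a - B < 0" unfolding b_eq using * by (intro mult_pos_neg) auto
      then show ?thesis unfolding eq using True assms(3) ln_iffs by (intro divide_neg_pos) auto
    next
      case False
      then have "a < 1" using assms(2) by simp
      then have "0 < b_of c a - B" unfolding b_eq using * by (intro mult_neg_neg) auto
      then show ?thesis
        unfolding eq using \<open>a < 1\<close> assms(3) ln_iffs by (intro divide_pos_neg mult_pos_neg) auto
    qed
  qed
  show "0 < \<kappa> a" if "x < profile_point c a"
  proof -
    have *: "0 < exp (c * profile_point c a) - exp (c * x)" using that assms by simp
    show ?thesis
    proof (cases "1 < a")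
      case True
      then have "0 < b_of c a - B" unfolding b_eq using * by (intro mult_pos_pos) auto
      then show ?thesis unfolding eq using True assms(3) ln_iffs by (intro divide_pos_pos) auto
    next
      case False
      then have "a < 1" using assms(2) by simp
      then have "b_of c a - B < 0" unfolding b_eq using * by (intro mult_neg_pos) auto
      then show ?thesis
        unfolding eq using \<open>a < 1\<close> assms(3) ln_iffs by (intro divide_neg_neg mult_pos_neg) auto
    qed
  qed
qed

lemma exponent_decreases_right:
  assumes "0 < a" "a \<noteq> 1" "0 < c" "0 < 1 + (a - 1) * exp (c * x)" "0 \<le> x" "profile_point c a < x"
  obtains a' where "a < a'" "0 < 1 + (a' - 1) * exp (c * x)" "exponent c a' x < exponent c a x"
proof -
  define \<kappa> where "\<kappa> a' = 1 / a - ln ((1 + (a' - 1) * exp (c * x)) / a') / (c * (a' - 1))" for a'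
  have "(\<kappa> \<longlongrightarrow> \<kappa> a) (at_right a)" "\<kappa> a < 0"
    using exponent_slope[OF assms(1-4), folded \<kappa>_def] assms(6)
    by (simp_all add: isCont_def filterlim_at_split)
  then have "\<forall>\<^sub>F a' in at_right a. \<kappa> a' < 0" by (rule order_tendstoD(2))
  moreover have "\<forall>\<^sub>F a' in at_right a. a' \<noteq> 1"
    using assms(2) by (intro eventually_neq_at_within)
  ultimately have "\<forall>\<^sub>F a' in at_right a. \<kappa> a' < 0 \<and> a' \<noteq> 1 \<and> a < a'"
    using eventually_at_right_less[of a] by eventually_elim auto
  from eventually_happens'[OF trivial_limit_at_right_real this]
  obtain a' where a': "\<kappa> a' < 0" "a' \<noteq> 1" "a < a'"
    by auto
  have "1 + (a - 1) * exp (c * x) \<le> 1 + (a' - 1) * exp (c * x)"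
    using a' by (intro add_left_mono mult_right_mono) auto
  then have D: "0 < 1 + (a' - 1) * exp (c * x)" using assms(4) by linarith
  have "exponent c a' x - exponent c a x \<le> (a' - a) * \<kappa> a'"
    unfolding \<kappa>_def using assms a' D by (intro exponent_diff_le) auto
  also have "\<dots> < 0" using a' by (simp add: mult_pos_neg)
  finally show ?thesis using a' D by (intro that[of a']) auto
qed

lemma exponent_decreases_left:
  assumes "0 < a" "a \<noteq> 1" "0 < c" "0 < 1 + (a - 1) * exp (c * x)" "0 \<le> x" "x < profile_point c a"
  obtains a' where "0 < a'" "a' < a" "0 < 1 + (a' - 1) * exp (c * x)" "exponent c a' x < exponent c a x"
proof -
  define \<kappa> where "\<kappa> a' = 1 / a - ln ((1 + (a' - 1) * exp (c * x)) / a') / (c * (a' - 1))" for a'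
  have "(\<kappa> \<longlongrightarrow> \<kappa> a) (at_left a)" "0 < \<kappa> a"
    using exponent_slope[OF assms(1-4), folded \<kappa>_def] assms(6)
    by (simp_all add: isCont_def filterlim_at_split)
  then have "\<forall>\<^sub>F a' in at_left a. 0 < \<kappa> a'" by (rule order_tendstoD(1))
  moreover have "\<forall>\<^sub>F a' in at_left a. a' \<noteq> 1"
    using assms(2) by (intro eventually_neq_at_within)
  moreover have "((\<lambda>a'. 1 + (a' - 1) * exp (c * x)) \<longlongrightarrow> 1 + (a - 1) * exp (c * x)) (at_left a)"
    by (intro tendsto_intros)
  then have "\<forall>\<^sub>F a' in at_left a. 0 < 1 + (a' - 1) * exp (c * x)"
    using assms(4) by (rule order_tendstoD(1))
  moreover have "\<forall>\<^sub>F a' in at_left a. a' \<in> {0<..<a}"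
    using assms(1) by (rule eventually_at_left_real)
  ultimately have "\<forall>\<^sub>F a' in at_left a. 0 < \<kappa> a' \<and> a' \<noteq> 1 \<and> 0 < 1 + (a' - 1) * exp (c * x) \<and> a' \<in> {0<..<a}"
    by eventually_elim auto
  from eventually_happens'[OF trivial_limit_at_left_real this]
  obtain a' where a': "0 < \<kappa> a'" "a' \<noteq> 1" "0 < 1 + (a' - 1) * exp (c * x)" "0 < a'" "a' < a"
    by auto
  have "exponent c a' x - exponent c a x \<le> (a' - a) * \<kappa> a'"
    unfolding \<kappa>_def using assms a' by (intro exponent_diff_le) auto
  also have "\<dots> < 0" using a' by (simp add: mult_neg_pos)
  finally show ?thesis using a' by (intro that[of a']) auto
qed

lemma exponent_tendsto:
  assumes "\<alpha> \<longlonglongrightarrow> a" "X \<longlonglongrightarrow> x" "0 < a" "0 < 1 + (a - 1) * exp (c * x)" "0 < c"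
  shows "(\<lambda>n. exponent c (\<alpha> n) (X n)) \<longlonglongrightarrow> exponent c a x"
  unfolding exponent_def using assms by (intro tendsto_intros log_integral_tendsto) auto

text \<open>The substitution \<open>u = 1 + (a - 1) * exp (c * y)\<close>, under which \<open>du = c * (u - 1) * dy\<close>.\<close>

lemma exponent_profile_point:
  assumes "0 < a" "a \<noteq> 1" "0 < c" "0 \<le> profile_point c a"
  shows "exponent c a (profile_point c a) =
    ln a + 1 / c * (LBINT u=ereal a..ereal (b_of c a). rate_integrand u)"
proof -
  define s where "s = profile_point c a"
  define g where "g y = 1 + (a - 1) * exp (c * y)" for y
  have g_s: "g s = b_of c a" using exp_profile_point[OF assms(3,1,2)] by (simp add: g_def s_def)
  have g_pos: "0 < g y" if "y \<in> {0..s}" for y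
    using affine_exp_pos[of a c s y] that g_s b_of_pos[OF assms(1), of c] assms by (auto simp: g_def)
  have g_ne: "g y \<noteq> 1" for y using assms by (simp add: g_def)
  have "(LBINT u=ereal (g 0)..ereal (g s). rate_integrand u) =
      (LBINT y=ereal 0..ereal s. ((a - 1) * (c * exp (c * y))) *\<^sub>R rate_integrand (g y))"
  proof (rule interval_integral_substitution_finite[symmetric])
    show "0 \<le> s" using assms by (simp add: s_def)
    show "(g has_real_derivative (a - 1) * (c * exp (c * y))) (at y within {0..s})" for y
      unfolding g_def by (auto intro!: derivative_eq_intros)
    have "continuous_on (g ` {0..s}) (\<lambda>u. ln u / (1 - u))"
      using g_pos g_ne by (intro continuous_intros) (auto simp: less_imp_neq[symmetric])
    then show "continuous_on (g ` {0..s}) rate_integrand"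
      by (rule continuous_on_eq) (use g_ne in \<open>auto simp: rate_integrand_def\<close>)
  qed (intro continuous_intros)
  also have "\<dots> = (LBINT y=ereal 0..ereal s. - c * ln (g y))"
  proof (rule interval_integral_cong)
    fix y
    have "((a - 1) * (c * exp (c * y))) * (ln (g y) / (1 - g y)) = - c * ln (g y)"
      using assms by (simp add: g_def field_simps)
    then show "((a - 1) * (c * exp (c * y))) *\<^sub>R rate_integrand (g y) = - c * ln (g y)"
      using g_ne by (simp add: rate_integrand_def)
  qed
  also have "\<dots> = - c * log_integral c a s"
    using assms by (subst interval_lebesgue_integral_mult_right) (auto simp: log_integral_interval s_def g_def)
  finally show ?thesis
    using assms(3) g_s by (simp add: exponent_def s_def[symmetric]) (simp add: g_def)
qed

section \<open>Concentration under the tilted law\<close>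

text \<open>The mass of \<open>T\<close> under the tilted law of the size, not normalized: its total is \<open>a ^ n\<close>.\<close>

definition weight_sum :: "real \<Rightarrow> nat \<Rightarrow> real \<Rightarrow> nat set \<Rightarrow> real" where
  "weight_sum c n a T = measure_pmf.expectation (greedy_size c n)
     (\<lambda>k. weight (1 - c / real n) a k * indicator T k)"

lemma integrable_greedy_size: "integrable (measure_pmf (greedy_size c n)) (h :: nat \<Rightarrow> real)"
  by (intro integrable_measure_pmf_finite finite_set_greedy_size)

lemma weight_sum_UNIV:
  "0 < c \<Longrightarrow> c < real n \<Longrightarrow> weight_sum c n a UNIV = a ^ n"
  by (simp add: weight_sum_def expectation_weight_greedy_size)

lemma weight_sum_mono:
  assumes "\<And>k. 0 \<le> weight (1 - c / real n) a k" "T \<subseteq> U"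
  shows "weight_sum c n a T \<le> weight_sum c n a U"
  unfolding weight_sum_def using assms
  by (intro integral_mono integrable_greedy_size mult_left_mono) (auto split: split_indicator)

lemma weight_sum_Un:
  assumes "T \<inter> U = {}"
  shows "weight_sum c n a (T \<union> U) = weight_sum c n a T + weight_sum c n a U"
  unfolding weight_sum_def using assms
  by (subst Bochner_Integration.integral_add[symmetric, OF integrable_greedy_size integrable_greedy_size])
     (simp add: indicator_union_arith indicator_inter_arith[symmetric] distrib_left)

lemma weight_sum_ge_prob:
  assumes "\<And>k. k \<in> T \<Longrightarrow> w \<le> weight (1 - c / real n) a k"
  shows "w * measure_pmf.prob (greedy_size c n) T \<le> weight_sum c n a T"
proof -
  have "w * measure_pmf.prob (greedy_size c n) T =
      measure_pmf.expectation (greedy_size c n) (\<lambda>k. w * indicator T k)"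
    by simp
  also have "\<dots> \<le> weight_sum c n a T"
    unfolding weight_sum_def using assms
    by (intro integral_mono integrable_greedy_size) (auto split: split_indicator)
  finally show ?thesis .
qed

lemma weight_sum_le_prob:
  assumes "\<And>k. k \<in> T \<Longrightarrow> weight (1 - c / real n) a k \<le> w"
  shows "weight_sum c n a T \<le> w * measure_pmf.prob (greedy_size c n) T"
proof -
  have "weight_sum c n a T \<le> measure_pmf.expectation (greedy_size c n) (\<lambda>k. w * indicator T k)"
    unfolding weight_sum_def using assms
    by (intro integral_mono integrable_greedy_size) (auto split: split_indicator)
  then show ?thesis by simp
qed

text \<open>A Chernoff bound for the tilted law, obtained by changing its parameter from \<open>a\<close> to \<open>g\<close>.\<close>

lemma weight_sum_tilt:
  assumes "0 < c" "c < real n" "\<And>k. 0 \<le> weight (1 - c / real n) g k"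
    and "0 < weight (1 - c / real n) g m" "0 \<le> weight (1 - c / real n) a m"
    and le: "\<And>k. k \<in> T \<Longrightarrow> weight (1 - c / real n) a k * weight (1 - c / real n) g m
      \<le> weight (1 - c / real n) g k * weight (1 - c / real n) a m"
  shows "weight_sum c n a T \<le> g ^ n * weight (1 - c / real n) a m / weight (1 - c / real n) g m"
proof -
  define R where "R = weight (1 - c / real n) a m / weight (1 - c / real n) g m"
  have "weight_sum c n a T \<le> measure_pmf.expectation (greedy_size c n)
      (\<lambda>k. R * (weight (1 - c / real n) g k * indicator T k))"
    unfolding weight_sum_def
  proof (intro integral_mono integrable_greedy_size)
    fix k show "weight (1 - c / real n) a k * indicator T k \<le> R * (weight (1 - c / real n) g k * indicator T k)"
      using le[of k] assms(4) by (auto simp: R_def field_simps split: split_indicator)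
  qed
  also have "\<dots> = R * weight_sum c n g T" by (simp add: weight_sum_def)
  also have "\<dots> \<le> R * weight_sum c n g UNIV"
    using assms(3-5) by (intro mult_left_mono weight_sum_mono) (auto simp: R_def)
  finally show ?thesis using assms(1,2) by (simp add: weight_sum_UNIV R_def mult_ac)
qed

lemma exponent_sequence_tendsto:
  fixes k :: "nat \<Rightarrow> nat"
  assumes "\<alpha> \<longlonglongrightarrow> a" "(\<lambda>n. real (k n) / real n) \<longlonglongrightarrow> x" "0 < a" "0 < 1 + (a - 1) * exp (c * x)" "0 < c"
  shows "(\<lambda>n. ln (\<alpha> n ^ n / weight (1 - c / real n) (\<alpha> n) (k n)) / real n) \<longlonglongrightarrow> exponent c a x"
proof -
  have "(\<lambda>n. ln (\<alpha> n) - ln (weight (1 - c / real n) (\<alpha> n) (k n)) / real n) \<longlonglongrightarrow> exponent c a x"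
    unfolding exponent_def using assms by (intro tendsto_intros ln_weight_tendsto) auto
  moreover have "\<forall>\<^sub>F n in sequentially. ln (\<alpha> n) - ln (weight (1 - c / real n) (\<alpha> n) (k n)) / real n =
      ln (\<alpha> n ^ n / weight (1 - c / real n) (\<alpha> n) (k n)) / real n"
    using order_tendstoD(1)[OF assms(1,3)] ln_weight_tendsto(1)[OF assms] eventually_gt_at_top[of 0]
    by eventually_elim (simp add: ln_div ln_realpow diff_divide_distrib)
  ultimately show ?thesis by (rule Lim_transform_eventually)
qed

text \<open>If changing the parameter from \<open>a\<close> to \<open>g\<close> lowers the exponent at \<open>x\<close>, then the part of the tilted mass on
  the side of \<open>x\<close> favoured by \<open>g\<close> is exponentially small.\<close>

lemma escaping_weight:
  fixes k :: "nat \<Rightarrow> nat" and T :: "nat \<Rightarrow> nat set"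
  assumes "admissible c \<alpha> a" "admissible c \<gamma> g" "0 < c" "0 < a" "0 < g"
    and k: "(\<lambda>n. real (k n) / real n) \<longlonglongrightarrow> x"
    and "0 < 1 + (a - 1) * exp (c * x)" "0 < 1 + (g - 1) * exp (c * x)"
    and less: "exponent c g x < exponent c a x"
    and le: "\<forall>\<^sub>F n in sequentially. \<forall>l\<in>T n.
      weight (1 - c / real n) (\<alpha> n) l * weight (1 - c / real n) (\<gamma> n) (k n)
      \<le> weight (1 - c / real n) (\<gamma> n) l * weight (1 - c / real n) (\<alpha> n) (k n)"
  shows "\<forall>\<^sub>F n in sequentially. weight_sum c n (\<alpha> n) (T n) \<le> \<alpha> n ^ n / 4"
proof -
  let ?w = "\<lambda>n a. weight (1 - c / real n) a (k n)"
  define \<eta> where "\<eta> = exponent c a x - exponent c g x"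
  have \<alpha>: "\<alpha> \<longlonglongrightarrow> a" and \<gamma>: "\<gamma> \<longlonglongrightarrow> g" using assms(1,2) by (auto simp: admissible_def)
  have nonneg: "\<forall>\<^sub>F n in sequentially. (\<forall>l. 0 \<le> weight (1 - c / real n) (\<gamma> n) l)"
    using assms(2) by (auto simp: admissible_def)
  have "(\<lambda>n. ln (\<alpha> n ^ n / ?w n (\<alpha> n)) / real n - ln (\<gamma> n ^ n / ?w n (\<gamma> n)) / real n) \<longlonglongrightarrow> \<eta>"
    unfolding \<eta>_def using assms \<alpha> \<gamma> by (intro tendsto_diff exponent_sequence_tendsto) auto
  moreover have "\<eta> / 2 < \<eta>" using less by (simp add: \<eta>_def)
  ultimately have gap: "\<forall>\<^sub>F n in sequentially. \<eta> / 2 <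
      ln (\<alpha> n ^ n / ?w n (\<alpha> n)) / real n - ln (\<gamma> n ^ n / ?w n (\<gamma> n)) / real n"
    by (rule order_tendstoD(1))
  have "\<forall>\<^sub>F n in sequentially. 2 * ln 4 / \<eta> < real n" by (rule eventually_gt_real)
  then show ?thesis
    using gap le nonneg eventually_gt_real[of c] order_tendstoD(1)[OF \<alpha> \<open>0 < a\<close>]
      order_tendstoD(1)[OF \<gamma> \<open>0 < g\<close>] ln_weight_tendsto(1)[OF \<alpha> k assms(4,7,3)]
      ln_weight_tendsto(1)[OF \<gamma> k assms(5,8,3)]
  proof eventually_elim
    case (elim n)
    have n: "0 < real n" using elim(5) assms(3) by linarith
    \<comment> \<open>The exponential gap \<open>exp (\<eta> * n / 2)\<close> between \<open>A\<close> and \<open>B\<close> exceeds \<open>4\<close> for large \<open>n\<close>.\<close>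
    define A where "A = \<alpha> n ^ n / ?w n (\<alpha> n)"
    define B where "B = \<gamma> n ^ n / ?w n (\<gamma> n)"
    have pos: "0 < A" "0 < B" using elim by (auto simp: A_def B_def)
    have "2 * ln 4 < \<eta> * real n" using elim(1) less by (simp add: \<eta>_def field_simps)
    moreover have "\<eta> / 2 * real n < ln A - ln B"
      using elim(2) n by (simp add: A_def B_def diff_divide_distrib[symmetric] pos_less_divide_eq)
    ultimately have "ln (B * 4) < ln A" using pos by (simp add: ln_mult)
    then have "B * 4 < A" using pos by simp
    have "weight_sum c n (\<alpha> n) (T n) \<le> \<gamma> n ^ n * ?w n (\<alpha> n) / ?w n (\<gamma> n)"
      using elim assms(3) by (intro weight_sum_tilt) auto
    also have "\<dots> = B * ?w n (\<alpha> n)" by (simp add: B_def)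
    also have "\<dots> \<le> A / 4 * ?w n (\<alpha> n)"
      using \<open>B * 4 < A\<close> elim by (intro mult_right_mono) auto
    also have "\<dots> = \<alpha> n ^ n / 4" using elim by (simp add: A_def)
    finally show ?case .
  qed
qed

text \<open>Under the tilted law the size is close to \<open>profile_point c a * n\<close>: to the right of this point a larger
  parameter lowers the exponent, to the left a smaller one does, so the mass on either side escapes.\<close>

lemma weight_concentrates:
  fixes k0 k1 :: "nat \<Rightarrow> nat"
  assumes "admissible c \<alpha> a" "0 < c" "0 < a" "a \<noteq> 1"
    and x: "0 \<le> x0" "x0 < profile_point c a" "profile_point c a < x1" "0 < 1 + (a - 1) * exp (c * x1)"
    and k: "(\<lambda>n. real (k0 n) / real n) \<longlonglongrightarrow> x0" "(\<lambda>n. real (k1 n) / real n) \<longlonglongrightarrow> x1"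
  shows "\<forall>\<^sub>F n in sequentially. \<alpha> n ^ n / 2 \<le> weight_sum c n (\<alpha> n) {k0 n..k1 n}"
proof -
  have \<alpha>: "\<alpha> \<longlonglongrightarrow> a" using assms(1) by (auto simp: admissible_def)
  have \<alpha>_nonneg: "\<forall>\<^sub>F n in sequentially. (\<forall>l. 0 \<le> weight (1 - c / real n) (\<alpha> n) l)"
    using assms(1) by (auto simp: admissible_def)
  have right: "\<forall>\<^sub>F n in sequentially. weight_sum c n (\<alpha> n) {k1 n<..} \<le> \<alpha> n ^ n / 4"
  proof -
    obtain g where g: "a < g" "0 < 1 + (g - 1) * exp (c * x1)" "exponent c g x1 < exponent c a x1"
      using exponent_decreases_right[of a c x1] assms(2-4) x by (metis less_eq_real_def less_trans)
    then have "0 < g" using assms(3) by simp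
    obtain \<gamma> where \<gamma>: "admissible c \<gamma> g"
      using admissible_sequence_exists[OF assms(2) \<open>0 < g\<close>] by blast
    then have lim: "\<gamma> \<longlonglongrightarrow> g" and \<gamma>_nonneg: "\<forall>\<^sub>F n in sequentially. (\<forall>l. 0 \<le> weight (1 - c / real n) (\<gamma> n) l)"
      by (auto simp: admissible_def)
    obtain z where z: "a < z" "z < g" using dense[OF g(1)] by auto
    have "\<forall>\<^sub>F n in sequentially. \<forall>l\<in>{k1 n<..}.
      weight (1 - c / real n) (\<alpha> n) l * weight (1 - c / real n) (\<gamma> n) (k1 n)
      \<le> weight (1 - c / real n) (\<gamma> n) l * weight (1 - c / real n) (\<alpha> n) (k1 n)"
      using \<alpha>_nonneg \<gamma>_nonneg order_tendstoD(2)[OF \<alpha> z(1)] order_tendstoD(1)[OF lim z(2)] eventually_gt_real[of c]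
    proof eventually_elim
      case (elim n)
      then show ?case using assms(2) by (intro ballI weight_ratio_mono) (auto simp: field_simps)
    qed
    then show ?thesis
      using escaping_weight[OF assms(1) \<gamma> assms(2,3) \<open>0 < g\<close> k(2) x(4) g(2,3)] by auto
  qed
  have x0: "0 < 1 + (a - 1) * exp (c * x0)"
    using affine_exp_pos[of a c x1 x0] assms(2,3) x by auto
  have left: "\<forall>\<^sub>F n in sequentially. weight_sum c n (\<alpha> n) {..<k0 n} \<le> \<alpha> n ^ n / 4"
  proof -
    obtain g where g: "0 < g" "g < a" "0 < 1 + (g - 1) * exp (c * x0)" "exponent c g x0 < exponent c a x0"
      using exponent_decreases_left[OF assms(3,4,2) x0 x(1,2)] by metis
    obtain \<gamma> where \<gamma>: "admissible c \<gamma> g"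
      using admissible_sequence_exists[OF assms(2) \<open>0 < g\<close>] by blast
    then have lim: "\<gamma> \<longlonglongrightarrow> g" and \<gamma>_nonneg: "\<forall>\<^sub>F n in sequentially. (\<forall>l. 0 \<le> weight (1 - c / real n) (\<gamma> n) l)"
      by (auto simp: admissible_def)
    obtain z where z: "g < z" "z < a" using dense[OF g(2)] by auto
    have "\<forall>\<^sub>F n in sequentially. \<forall>l\<in>{..<k0 n}.
      weight (1 - c / real n) (\<alpha> n) l * weight (1 - c / real n) (\<gamma> n) (k0 n)
      \<le> weight (1 - c / real n) (\<gamma> n) l * weight (1 - c / real n) (\<alpha> n) (k0 n)"
      using \<alpha>_nonneg \<gamma>_nonneg order_tendstoD(1)[OF \<alpha> z(2)] order_tendstoD(2)[OF lim z(1)] eventually_gt_real[of c]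
    proof eventually_elim
      case (elim n)
      show ?case
      proof
        fix l assume "l \<in> {..<k0 n}"
        then show "weight (1 - c / real n) (\<alpha> n) l * weight (1 - c / real n) (\<gamma> n) (k0 n)
          \<le> weight (1 - c / real n) (\<gamma> n) l * weight (1 - c / real n) (\<alpha> n) (k0 n)"
          using weight_ratio_mono[of "\<gamma> n" "\<alpha> n" "1 - c / real n" l "k0 n"] elim assms(2)
          by (auto simp: mult.commute divide_less_eq)
      qed
    qed
    then show ?thesis
      using escaping_weight[OF assms(1) \<gamma> assms(2,3) \<open>0 < g\<close> k(1) x0 g(3,4)] by auto
  qed
  have "\<forall>\<^sub>F n in sequentially. real (k0 n) / real n < real (k1 n) / real n"
  proof -
    obtain z where "x0 < z" "z < x1" using x dense[of x0 x1] by auto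
    from order_tendstoD(2)[OF k(1) this(1)] order_tendstoD(1)[OF k(2) this(2)] show ?thesis
      by eventually_elim simp
  qed
  then show ?thesis
    using left right eventually_gt_real[of c]
  proof eventually_elim
    case (elim n)
    have "0 < real n" using elim(4) assms(2) by linarith
    then have "k0 n < k1 n" using elim(1) by (simp add: divide_less_cancel)
    then have "weight_sum c n (\<alpha> n) UNIV =
        weight_sum c n (\<alpha> n) (({..<k0 n} \<union> {k0 n..k1 n}) \<union> {k1 n<..})"
      by (intro arg_cong[where f = "weight_sum c n (\<alpha> n)"]) auto
    also have "\<dots> = weight_sum c n (\<alpha> n) ({..<k0 n} \<union> {k0 n..k1 n}) + weight_sum c n (\<alpha> n) {k1 n<..}"
      using \<open>k0 n < k1 n\<close> by (intro weight_sum_Un) auto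
    also have "weight_sum c n (\<alpha> n) ({..<k0 n} \<union> {k0 n..k1 n}) =
        weight_sum c n (\<alpha> n) {..<k0 n} + weight_sum c n (\<alpha> n) {k0 n..k1 n}"
      by (intro weight_sum_Un) auto
    finally show ?case using elim assms(2) by (simp add: weight_sum_UNIV)
  qed
qed

section \<open>Tail probabilities\<close>

text \<open>Markov's inequality for the weight.\<close>

lemma tail_upper_bound:
  fixes k :: "nat \<Rightarrow> nat" and T :: "nat \<Rightarrow> nat set"
  assumes "admissible c \<alpha> a" "0 < c" "0 < a" "0 < 1 + (a - 1) * exp (c * x)"
    and k: "(\<lambda>n. real (k n) / real n) \<longlonglongrightarrow> x"
    and le: "\<forall>\<^sub>F n in sequentially. \<forall>l\<in>T n. weight (1 - c / real n) (\<alpha> n) (k n) \<le> weight (1 - c / real n) (\<alpha> n) l"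
    and u: "exponent c a x < u"
  shows "\<forall>\<^sub>F n in sequentially. 0 < measure_pmf.prob (greedy_size c n) (T n) \<longrightarrow>
    ln (measure_pmf.prob (greedy_size c n) (T n)) / real n < u"
proof -
  have \<alpha>: "\<alpha> \<longlonglongrightarrow> a" "\<forall>\<^sub>F n in sequentially. (\<forall>l. 0 \<le> weight (1 - c / real n) (\<alpha> n) l)"
    using assms(1) by (auto simp: admissible_def)
  show ?thesis
    using le \<alpha>(2) eventually_gt_real[of c] ln_weight_tendsto(1)[OF \<alpha>(1) k assms(3,4,2)]
      order_tendstoD(2)[OF exponent_sequence_tendsto[OF \<alpha>(1) k assms(3,4,2)] u]
      order_tendstoD(1)[OF \<alpha>(1) assms(3)]
  proof eventually_elim
    case (elim n)
    let ?P = "measure_pmf.prob (greedy_size c n) (T n)" and ?w = "weight (1 - c / real n) (\<alpha> n) (k n)"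
    have "?w * ?P \<le> weight_sum c n (\<alpha> n) (T n)"
      using elim by (intro weight_sum_ge_prob) auto
    also have "\<dots> \<le> weight_sum c n (\<alpha> n) UNIV"
      using elim by (intro weight_sum_mono) auto
    finally have P: "?P \<le> \<alpha> n ^ n / ?w"
      using elim assms(2) by (simp add: weight_sum_UNIV field_simps)
    show ?case
    proof
      assume "0 < ?P"
      then have "ln ?P \<le> ln (\<alpha> n ^ n / ?w)" using P by (intro ln_mono) auto
      then have "ln ?P / real n \<le> ln (\<alpha> n ^ n / ?w) / real n" by (rule divide_right_mono) simp
      then show "ln ?P / real n < u" using elim by linarith
    qed
  qed
qed

text \<open>Half of the tilted mass lies in the window \<open>{k0 n..k1 n}\<close>, where the weight is at most its value at one
  end point \<open>k n\<close>. Dividing by this value turns tilted mass into probability.\<close>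

lemma tail_lower_bound:
  fixes k k0 k1 :: "nat \<Rightarrow> nat" and T :: "nat \<Rightarrow> nat set"
  assumes adm: "admissible c \<alpha> a" "0 < c" "0 < a" "a \<noteq> 1"
    and x: "0 \<le> x0" "x0 < profile_point c a" "profile_point c a < x1" "0 < 1 + (a - 1) * exp (c * x1)"
    and k01: "(\<lambda>n. real (k0 n) / real n) \<longlonglongrightarrow> x0" "(\<lambda>n. real (k1 n) / real n) \<longlonglongrightarrow> x1"
    and k: "(\<lambda>n. real (k n) / real n) \<longlonglongrightarrow> y" "0 < 1 + (a - 1) * exp (c * y)"
    and le: "\<forall>\<^sub>F n in sequentially. \<forall>l\<in>{k0 n..k1 n}. weight (1 - c / real n) (\<alpha> n) l \<le> weight (1 - c / real n) (\<alpha> n) (k n)"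
    and sub: "\<forall>\<^sub>F n in sequentially. {k0 n..k1 n} \<subseteq> T n"
    and u: "u < exponent c a y"
  shows "\<forall>\<^sub>F n in sequentially. 0 < measure_pmf.prob (greedy_size c n) (T n) \<and>
    u < ln (measure_pmf.prob (greedy_size c n) (T n)) / real n"
proof -
  have \<alpha>: "\<alpha> \<longlonglongrightarrow> a" using adm(1) by (auto simp: admissible_def)
  have "(\<lambda>n. ln (\<alpha> n ^ n / weight (1 - c / real n) (\<alpha> n) (k n)) / real n - ln 2 / real n) \<longlonglongrightarrow> exponent c a y - 0"
    using exponent_sequence_tendsto[OF \<alpha> k(1) adm(3) k(2) adm(2)] by (intro tendsto_diff) (auto, real_asymp)
  from order_tendstoD(1)[OF this, of u] u
  have "\<forall>\<^sub>F n in sequentially. u < ln (\<alpha> n ^ n / weight (1 - c / real n) (\<alpha> n) (k n)) / real n - ln 2 / real n"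
    by simp
  then show ?thesis
    using le sub eventually_gt_real[of c] ln_weight_tendsto(1)[OF \<alpha> k(1) adm(3) k(2) adm(2)]
      weight_concentrates[OF adm x k01] order_tendstoD(1)[OF \<alpha> adm(3)]
  proof eventually_elim
    case (elim n)
    let ?P = "measure_pmf.prob (greedy_size c n) (T n)" and ?w = "weight (1 - c / real n) (\<alpha> n) (k n)"
    have "\<alpha> n ^ n / 2 \<le> weight_sum c n (\<alpha> n) {k0 n..k1 n}" using elim by simp
    also have "\<dots> \<le> ?w * measure_pmf.prob (greedy_size c n) {k0 n..k1 n}"
      using elim by (intro weight_sum_le_prob) auto
    also have "\<dots> \<le> ?w * ?P"
      using elim by (intro mult_left_mono measure_pmf.finite_measure_mono) auto
    finally have P: "\<alpha> n ^ n / ?w / 2 \<le> ?P" using elim by (simp add: field_simps)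
    define X where "X = \<alpha> n ^ n / ?w"
    have X: "0 < X" "X / 2 \<le> ?P" "u < ln X / real n - ln 2 / real n"
      using elim P by (auto simp: X_def)
    then have "ln X - ln 2 \<le> ln ?P"
      using ln_mono[OF X(2)] by (simp add: ln_div)
    then have "ln X / real n - ln 2 / real n \<le> ln ?P / real n"
      by (simp add: diff_divide_distrib[symmetric] divide_right_mono)
    then show ?case using X by linarith
  qed
qed

lemma nat_round_tendsto:
  fixes t :: "nat \<Rightarrow> real"
  assumes "t \<longlonglongrightarrow> x" "0 < x"
  shows "(\<lambda>n. real (nat \<lceil>t n * real n\<rceil>) / real n) \<longlonglongrightarrow> x"
    and "(\<lambda>n. real (nat \<lfloor>t n * real n\<rfloor>) / real n) \<longlonglongrightarrow> x"
proof -
  have near: "(\<lambda>n. f n / real n) \<longlonglongrightarrow> x"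
    if "\<forall>\<^sub>F n in sequentially. 0 \<le> t n * real n \<longrightarrow> \<bar>f n - t n * real n\<bar> \<le> 1" for f :: "nat \<Rightarrow> real"
  proof -
    have "(\<lambda>n. f n / real n - t n) \<longlonglongrightarrow> 0"
    proof (rule Lim_null_comparison)
      show "\<forall>\<^sub>F n in sequentially. norm (f n / real n - t n) \<le> 1 / real n"
        using that order_tendstoD(1)[OF assms] eventually_gt_at_top[of 0]
      proof eventually_elim
        case (elim n)
        have "f n / real n - t n = (f n - t n * real n) / real n"
          using elim by (simp add: diff_divide_distrib)
        then have "norm (f n / real n - t n) = \<bar>f n - t n * real n\<bar> / real n" by simp
        also have "\<dots> \<le> 1 / real n" using elim by (intro divide_right_mono) auto
        finally show ?case .
      qed
    qed real_asymp
    from tendsto_add[OF this assms(1)] show ?thesis by simp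
  qed
  show "(\<lambda>n. real (nat \<lceil>t n * real n\<rceil>) / real n) \<longlonglongrightarrow> x"
    by (rule near) (auto intro!: always_eventually, linarith)
  show "(\<lambda>n. real (nat \<lfloor>t n * real n\<rfloor>) / real n) \<longlonglongrightarrow> x"
    by (rule near) (auto intro!: always_eventually, linarith)
qed

text \<open>For \<open>a > 1\<close> the weights increase with the size, which is what Markov's inequality needs for an upper tail.
  The lower bound holds with a slightly larger parameter and passes to the limit because the exponent is
  jointly continuous.\<close>

lemma tail_limit_above:
  assumes "0 < c" "1 < a" "0 < profile_point c a" and t: "t \<longlonglongrightarrow> profile_point c a"
  shows "(\<lambda>n. ln (measure_pmf.prob (greedy_size c n) {k. t n * real n \<le> real k}) / real n)
    \<longlonglongrightarrow> exponent c a (profile_point c a)"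
proof -
  define s where "s = profile_point c a"
  define T where "T n = {k. t n * real n \<le> real k}" for n
  define k where "k n = nat \<lceil>t n * real n\<rceil>" for n
  have a: "0 < a" "a \<noteq> 1" using assms(2) by auto
  have D: "0 < 1 + (b - 1) * exp (c * x)" if "1 < b" for b x
    using that by (simp add: add_pos_pos)
  have k: "(\<lambda>n. real (k n) / real n) \<longlonglongrightarrow> s"
    unfolding k_def s_def by (rule nat_round_tendsto(1)[OF t assms(3)])
  have T: "l \<in> T n \<longleftrightarrow> k n \<le> l" for n l
    by (auto simp: T_def k_def nat_le_iff ceiling_le_iff)
  have adm: "admissible c (\<lambda>_. b) b" if b: "1 < b" for b
  proof -
    have "\<forall>\<^sub>F n in sequentially. \<forall>l. 0 \<le> weight (1 - c / real n) b l"
      using eventually_gt_real[of c]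
    proof eventually_elim
      case (elim n)
      then show ?case using b assms(1) by (intro allI weight_nonneg_ge1) (auto simp: divide_less_eq)
    qed
    then show ?thesis by (simp add: admissible_def)
  qed
  have mono: "\<forall>\<^sub>F n in sequentially. \<forall>l m. l \<le> m \<longrightarrow> weight (1 - c / real n) b l \<le> weight (1 - c / real n) b m"
    if b: "1 < b" for b
    using eventually_gt_real[of c]
  proof eventually_elim
    case (elim n)
    then show ?case using b assms(1) by (intro allI impI weight_mono) (auto simp: divide_less_eq)
  qed
  have upper: "\<forall>\<^sub>F n in sequentially. 0 < measure_pmf.prob (greedy_size c n) (T n) \<longrightarrow>
      ln (measure_pmf.prob (greedy_size c n) (T n)) / real n < u" if u: "exponent c a s < u" for u
  proof (rule tail_upper_bound[OF adm[OF assms(2)] assms(1) a(1) D[OF assms(2)] k _ u])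
    show "\<forall>\<^sub>F n in sequentially. \<forall>l\<in>T n. weight (1 - c / real n) a (k n) \<le> weight (1 - c / real n) a l"
      using mono[OF assms(2)] by eventually_elim (auto simp: T)
  qed
  have lower: "\<forall>\<^sub>F n in sequentially. 0 < measure_pmf.prob (greedy_size c n) (T n) \<and>
      u < ln (measure_pmf.prob (greedy_size c n) (T n)) / real n" if u: "u < exponent c a s" for u
  proof -
    \<comment> \<open>A slightly larger parameter moves the typical value to just above \<open>s\<close>, so that a short
      window around it lies inside the tail.\<close>
    define b where "b m = a + 1 / real (Suc m)" for m
    define y where "y m = profile_point c (b m) + 1 / real (Suc m)" for m
    have b: "a < b m" "1 < b m" for m
    proof -
      show "a < b m" by (simp add: b_def)
      then show "1 < b m" using assms(2) by simp
    qed
    have b_lim: "b \<longlonglongrightarrow> a + 0" unfolding b_def by (intro tendsto_add tendsto_const LIMSEQ_Suc lim_1_over_n)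
    have "isCont (profile_point c) a"
      unfolding profile_point_def[abs_def] using assms(1) a profile_ratio_pos[OF assms(1) a]
      by (intro continuous_intros isCont_b_of) auto
    from isCont_tendsto_compose[OF this] b_lim have "(\<lambda>m. profile_point c (b m)) \<longlonglongrightarrow> s"
      by (simp add: s_def)
    then have "y \<longlonglongrightarrow> s + 0" unfolding y_def by (intro tendsto_add LIMSEQ_Suc lim_1_over_n)
    then have "(\<lambda>m. exponent c (b m) (y m)) \<longlonglongrightarrow> exponent c a s"
      using b_lim assms(1) a D[OF assms(2)] by (intro exponent_tendsto) auto
    from order_tendstoD(1)[OF this u] obtain m where m: "u < exponent c (b m) (y m)"
      by (auto dest: eventually_happens)
    have s_less: "s < profile_point c (b m)"
      unfolding s_def by (rule profile_point_above[OF assms(1,2) b(1)])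
    then have less: "profile_point c (b m) < y m" "0 < y m" "0 \<le> s"
      using assms(3) by (auto simp: y_def s_def add_pos_pos)
    define k1 where "k1 n = nat \<lfloor>y m * real n\<rfloor>" for n
    have k1: "(\<lambda>n. real (k1 n) / real n) \<longlonglongrightarrow> y m"
      unfolding k1_def by (rule nat_round_tendsto(2)) (use less in auto)
    show ?thesis
    proof (rule tail_lower_bound[OF adm[OF b(2)] assms(1) _ _ less(3) s_less less(1) D[OF b(2)] k k1 k1
          D[OF b(2)] _ _ m])
      show "\<forall>\<^sub>F n in sequentially. \<forall>l\<in>{k n..k1 n}. weight (1 - c / real n) (b m) l \<le> weight (1 - c / real n) (b m) (k1 n)"
        using mono[OF b(2)[of m]] by eventually_elim auto
      show "\<forall>\<^sub>F n in sequentially. {k n..k1 n} \<subseteq> T n"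
        by (intro always_eventually) (auto simp: T)
    qed (use b(2)[of m] in auto)
  qed
  show ?thesis
    unfolding s_def[symmetric] T_def[symmetric]
  proof (rule order_tendstoI)
    fix u assume "u < exponent c a s"
    from lower[OF this] show "\<forall>\<^sub>F n in sequentially. u < ln (measure_pmf.prob (greedy_size c n) (T n)) / real n"
      by eventually_elim simp
  next
    fix u assume "exponent c a s < u"
    from upper[OF this] lower[of "exponent c a s - 1", simplified]
    show "\<forall>\<^sub>F n in sequentially. ln (measure_pmf.prob (greedy_size c n) (T n)) / real n < u"
      by eventually_elim simp
  qed
qed

text \<open>The mirror image of the upper tail: for \<open>a < 1\<close> the weights decrease with the size. The window ends at \<open>s\<close>
  and its left end, where the weights are largest, determines the bound.\<close>

lemma tail_limit_below:
  assumes "0 < c" "0 < a" "a < 1" "0 < profile_point c a" and t: "t \<longlonglongrightarrow> profile_point c a"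
  shows "(\<lambda>n. ln (measure_pmf.prob (greedy_size c n) {k. real k \<le> t n * real n}) / real n)
    \<longlonglongrightarrow> exponent c a (profile_point c a)"
proof -
  define s where "s = profile_point c a"
  define T where "T n = {k. real k \<le> t n * real n}" for n
  define k where "k n = nat \<lfloor>t n * real n\<rfloor>" for n
  have a: "a \<noteq> 1" using assms(3) by auto
  have s: "0 < s" using assms(4) by (simp add: s_def)
  have D: "0 < 1 + (a - 1) * exp (c * s)"
    using exp_profile_point[OF assms(1,2) a] b_of_pos[OF assms(2), of c] by (simp add: s_def)
  have k: "(\<lambda>n. real (k n) / real n) \<longlonglongrightarrow> s"
    unfolding k_def s_def by (rule nat_round_tendsto(2)[OF t assms(4)])
  have T: "\<forall>\<^sub>F n in sequentially. \<forall>l. l \<in> T n \<longleftrightarrow> l \<le> k n"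
    using order_tendstoD(1)[OF t assms(4)]
  proof eventually_elim
    case (elim n)
    then have "0 \<le> t n * real n" by simp
    then show ?case by (auto simp: T_def k_def le_nat_iff le_floor_iff)
  qed
  have antimono: "\<forall>\<^sub>F n in sequentially. \<forall>l m. l \<le> m \<longrightarrow>
      weight (1 - c / real n) (\<beta> n) m \<le> weight (1 - c / real n) (\<beta> n) l"
    if \<beta>: "admissible c \<beta> b" "b < 1" for \<beta> b
  proof -
    have "\<beta> \<longlonglongrightarrow> b" "\<forall>\<^sub>F n in sequentially. \<forall>l. 0 \<le> weight (1 - c / real n) (\<beta> n) l"
      using \<beta>(1) by (auto simp: admissible_def)
    from this(2) order_tendstoD(2)[OF this(1) \<beta>(2)] eventually_gt_real[of c] show ?thesis
    proof eventually_elim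
      case (elim n)
      then show ?case using assms(1) by (intro allI impI weight_antimono) (auto simp: divide_less_eq)
    qed
  qed
  have upper: "\<forall>\<^sub>F n in sequentially. 0 < measure_pmf.prob (greedy_size c n) (T n) \<longrightarrow>
      ln (measure_pmf.prob (greedy_size c n) (T n)) / real n < u" if u: "exponent c a s < u" for u
  proof -
    obtain \<alpha> where \<alpha>: "admissible c \<alpha> a"
      using admissible_sequence_exists[OF assms(1,2)] by blast
    show ?thesis
    proof (rule tail_upper_bound[OF \<alpha> assms(1,2) D k _ u])
      show "\<forall>\<^sub>F n in sequentially. \<forall>l\<in>T n. weight (1 - c / real n) (\<alpha> n) (k n) \<le> weight (1 - c / real n) (\<alpha> n) l"
        using antimono[OF \<alpha> assms(3)] T by eventually_elim auto
    qed
  qed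
  have lower: "\<forall>\<^sub>F n in sequentially. 0 < measure_pmf.prob (greedy_size c n) (T n) \<and>
      u < ln (measure_pmf.prob (greedy_size c n) (T n)) / real n" if u: "u < exponent c a s" for u
  proof -
    \<comment> \<open>A slightly smaller parameter moves the typical value to just below \<open>s\<close>; starting at
      \<open>a / 2\<close> keeps \<open>b m\<close> positive.\<close>
    define b where "b m = a - a / real (Suc (Suc m))" for m
    define y where "y m = profile_point c (b m) - 1 / real (Suc m)" for m
    have b: "0 < b m" "b m < a" "b m < 1" for m
    proof -
      show "0 < b m" "b m < a" using assms(2) by (auto simp: b_def field_simps add_pos_nonneg)
      then show "b m < 1" using assms(3) by linarith
    qed
    have b_lim: "b \<longlonglongrightarrow> a" unfolding b_def by real_asymp
    have "isCont (profile_point c) a"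
      unfolding profile_point_def[abs_def] using assms(1) a profile_ratio_pos[OF assms(1,2) a] assms(2)
      by (intro continuous_intros isCont_b_of) auto
    from isCont_tendsto_compose[OF this b_lim] have "(\<lambda>m. profile_point c (b m)) \<longlonglongrightarrow> s"
      by (simp add: s_def)
    then have "y \<longlonglongrightarrow> s - 0" unfolding y_def by (intro tendsto_diff LIMSEQ_Suc lim_1_over_n)
    then have y_lim: "y \<longlonglongrightarrow> s" by simp
    have "(\<lambda>m. exponent c (b m) (y m)) \<longlonglongrightarrow> exponent c a s"
      using b_lim y_lim assms(1,2) a D by (intro exponent_tendsto) auto
    note ev1 = order_tendstoD(1)[OF this u]
    have "(\<lambda>m. 1 + (b m - 1) * exp (c * s)) \<longlonglongrightarrow> 1 + (a - 1) * exp (c * s)"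
      using b_lim by (intro tendsto_intros)
    note ev2 = order_tendstoD(1)[OF this D]
    from eventually_happens[OF eventually_conj[OF ev1 eventually_conj[OF ev2 order_tendstoD(1)[OF y_lim s]]]]
    obtain m where m: "u < exponent c (b m) (y m)" "0 < 1 + (b m - 1) * exp (c * s)" "0 < y m"
      by auto
    have less_s: "profile_point c (b m) < s"
      unfolding s_def by (rule profile_point_below[OF assms(1) b(1,2) assms(3)])
    have less: "y m < profile_point c (b m)" "0 \<le> y m" using m(3) by (auto simp: y_def)
    have Dy: "0 < 1 + (b m - 1) * exp (c * y m)"
      using affine_exp_pos[OF b(1) m(2) less(2) _ assms(1)] less less_s by simp
    define k0 where "k0 n = nat \<lceil>y m * real n\<rceil>" for n
    have k0: "(\<lambda>n. real (k0 n) / real n) \<longlonglongrightarrow> y m"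
      unfolding k0_def by (rule nat_round_tendsto(1)) (use m in auto)
    obtain \<beta> where \<beta>: "admissible c \<beta> (b m)"
      using admissible_sequence_exists[OF assms(1) b(1)] by blast
    show ?thesis
    proof (rule tail_lower_bound[OF \<beta> assms(1) b(1) _ less(2,1) less_s m(2) k0 k k0 Dy _ _ m(1)])
      show "\<forall>\<^sub>F n in sequentially. \<forall>l\<in>{k0 n..k n}. weight (1 - c / real n) (\<beta> n) l \<le> weight (1 - c / real n) (\<beta> n) (k0 n)"
        using antimono[OF \<beta> b(3)[of m]] by eventually_elim auto
      show "\<forall>\<^sub>F n in sequentially. {k0 n..k n} \<subseteq> T n"
        using T by (rule eventually_mono) (simp add: subset_iff)
    qed (use b(3)[of m] in auto)
  qed
  show ?thesis
    unfolding s_def[symmetric] T_def[symmetric]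
  proof (rule order_tendstoI)
    fix u assume "u < exponent c a s"
    from lower[OF this] show "\<forall>\<^sub>F n in sequentially. u < ln (measure_pmf.prob (greedy_size c n) (T n)) / real n"
      by eventually_elim simp
  next
    fix u assume "exponent c a s < u"
    from upper[OF this] lower[of "exponent c a s - 1", simplified]
    show "\<forall>\<^sub>F n in sequentially. ln (measure_pmf.prob (greedy_size c n) (T n)) / real n < u"
      by eventually_elim simp
  qed
qed

section \<open>The large deviation limit\<close>

theorem theorem1:
  fixes c s :: real
  assumes "0 < c" and "0 < s" and "s < 1" and "s \<noteq> s_crit c"
  shows "(\<exists>!a. 0 < a \<and> a \<noteq> 1 \<and> s = 1 / c * ln ((b_of c a - 1) / (a - 1))) \<and>
    (\<forall>a. 0 < a \<and> a \<noteq> 1 \<and> s = 1 / c * ln ((b_of c a - 1) / (a - 1)) \<longrightarrow>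
      (\<forall>sn :: nat \<Rightarrow> real. sn \<longlonglongrightarrow> s \<longrightarrow>
        (\<lambda>n. 1 / real n * ln (tail_prob c n (sn n)))
          \<longlonglongrightarrow> ln a + 1 / c * (LBINT u = ereal a..ereal (b_of c a). rate_integrand u)))"
proof -
  obtain p where p: "0 < p" "p \<noteq> 1" "profile_point c p = s" "1 < p \<longleftrightarrow> s_crit c < s"
    by (rule profile_parameter_exists[OF assms])
  have unique: "a = p" if "0 < a" "a \<noteq> 1" "s = profile_point c a" for a
    using profile_point_inj[OF assms(1) that(1,2) p(1,2)] that(3) p(3) by simp
  have limit: "(\<lambda>n. 1 / real n * ln (tail_prob c n (sn n)))
      \<longlonglongrightarrow> ln p + 1 / c * (LBINT u = ereal p..ereal (b_of c p). rate_integrand u)"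
    if sn: "sn \<longlonglongrightarrow> s" for sn
  proof -
    have s: "0 < profile_point c p" "sn \<longlonglongrightarrow> profile_point c p" using assms(2) p(3) sn by auto
    have "(\<lambda>n. ln (tail_prob c n (sn n)) / real n) \<longlonglongrightarrow> exponent c p (profile_point c p)"
    proof (cases "1 < p")
      case True
      then have "s_crit c < s" using p(4) by simp
      have "\<forall>\<^sub>F n in sequentially. ln (measure_pmf.prob (greedy_size c n) {k. sn n * real n \<le> real k}) / real n
          = ln (tail_prob c n (sn n)) / real n"
        using order_tendstoD(1)[OF sn \<open>s_crit c < s\<close>] by eventually_elim (simp add: tail_prob_def)
      then show ?thesis by (rule Lim_transform_eventually[OF tail_limit_above[OF assms(1) True s]])
    next
      case False
      then have "p < 1" "s < s_crit c" using p(2,4) assms(4) by auto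
      have "\<forall>\<^sub>F n in sequentially. ln (measure_pmf.prob (greedy_size c n) {k. real k \<le> sn n * real n}) / real n
          = ln (tail_prob c n (sn n)) / real n"
        using order_tendstoD(2)[OF sn \<open>s < s_crit c\<close>] by eventually_elim (simp add: tail_prob_def)
      then show ?thesis by (rule Lim_transform_eventually[OF tail_limit_below[OF assms(1) p(1) \<open>p < 1\<close> s]])
    qed
    also have "exponent c p (profile_point c p) =
        ln p + 1 / c * (LBINT u = ereal p..ereal (b_of c p). rate_integrand u)"
      using s p assms by (intro exponent_profile_point) auto
    finally show ?thesis by simp
  qed
  show ?thesis
    unfolding profile_point_def[symmetric]
  proof (intro conjI allI impI)
    show "\<exists>!a. 0 < a \<and> a \<noteq> 1 \<and> s = profile_point c a"
    proof (rule ex1I[of _ p])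
      show "0 < p \<and> p \<noteq> 1 \<and> s = profile_point c p" using p by simp
    qed (elim conjE, rule unique)
  next
    fix a :: real and sn :: "nat \<Rightarrow> real"
    assume a: "0 < a \<and> a \<noteq> 1 \<and> s = profile_point c a" and sn: "sn \<longlonglongrightarrow> s"
    have "a = p" by (rule unique) (use a in auto)
    with limit[OF sn] show "(\<lambda>n. 1 / real n * ln (tail_prob c n (sn n)))
      \<longlonglongrightarrow> ln a + 1 / c * (LBINT u = ereal a..ereal (b_of c a). rate_integrand u)"
      by simp
  qed
qed

end
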